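(* Let $\mathbf X_1,\dots,\mathbf X_n$ be i.i.d. random vectors in $\mathbb R^d$ with continuous marginal distribution functions and copula density $c$. Assume that $$\|c\|_2^2=\sum_{\mathbf m\in\mathbb N^d}\rho_{\mathbf m}^2<\infty ,$$ i.e. that $c$ belongs to $L^2([0,1]^d)$. Let $\mathbf N=\mathbf N(n)=(N_1,\dots,N_d)^T\in\mathbb N^d$ and assume that $N_{\max}^{2d+4}=o(n)$, where $N_{\max}=\max_{j=1,\dots,d}N_j$. Then the copula density estimator $\widehat c^{[\mathbf N]}$ is asymptotically consistent in the integrated mean squared sense, that is, $$\mathrm{MISE}(\widehat c^{[\mathbf N]})\longrightarrow0\qquad\text{as } n\to\infty .$$
   Context: $\mathbb N=\{0,1,2,\dots\}$. $Q_m(x)=\sqrt{2m+1}\,L_m(2x-1)$, $x\in[0,1]$, are the orthonormal shifted Legendre polynomials, where $L_0=1$, $L_1(x)=x$, $(m+1)L_{m+1}(x)=(2m+1)xL_m(x)-mL_{m-1}(x)$. Write $\mathbf X_i=(X_{i1},\dots,X_{id})^T$ with marginal distribution functions $F_1,\dots,F_d$, and $\widehat F_j(x)=\frac1n\sum_{i=1}^n\mathbf 1(X_{ij}\le x)$. The copula density $c$ is the density with respect to Lebesgue measure on $[0,1]^d$ of $(F_1(X_{11}),\dots,F_d(X_{1d}))$. $\|\cdot\|_2$ is the $L^2$ norm with respect to Lebesgue measure on $[0,1]^d$. For $\mathbf m=(m_1,\dots,m_d)^T\in\mathbb N^d$, the copula coefficients are $\rho_{\mathbf m}=\mathbb E\big(\prod_{j=1}^dQ_{m_j}(F_j(X_{1j}))\big)$,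 and their estimators are: $\widehat\rho_{\mathbf m}=1$ if $\mathbf m=\mathbf 0$; $\widehat\rho_{\mathbf m}=0$ if exactly $d-1$ components of $\mathbf m$ are zero; and $\widehat\rho_{\mathbf m}=\frac1n\sum_{i=1}^n\prod_{j=1}^dQ_{m_j}(\widehat F_j(X_{ij}))$ otherwise. With $\mathbf m\le\mathbf N$ meaning $m_j\le N_j$ for all $j=1,\dots,d$, the estimator is $\widehat c^{[\mathbf N]}(\mathbf u)=\sum_{\mathbf m\le\mathbf N}\widehat\rho_{\mathbf m}\prod_{j=1}^dQ_{m_j}(u_j)$ for $\mathbf u=(u_1,\dots,u_d)^T\in[0,1]^d$, and $\mathrm{MISE}(\widehat c^{[\mathbf N]})=\mathbb E\|\widehat c^{[\mathbf N]}-c\|_2^2=\mathbb E\int_{[0,1]^d}(\widehat c^{[\mathbf N]}(\mathbf u)-c(\mathbf u))^2\,d\mathbf u$.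
   Formalization: The formal theorem also assumes that every N_j(n) tends to infinity; without this the claim fails, e.g. for N(n) = 0 and c(u,v) = 1 + (2u-1)(2v-1), where the estimator is constantly 1 and the MISE is 1/9 for all n. *)

theory Defs
  imports "HOL-Probability.Probability" "HOL-Library.Landau_Symbols"
begin

fun legendre :: "nat \<Rightarrow> real \<Rightarrow> real" where
  "legendre 0 x = 1"
| "legendre (Suc 0) x = x"
| "legendre (Suc (Suc m)) x =
     (real (2 * Suc m + 1) * x * legendre (Suc m) x - real (Suc m) * legendre m x)
       / real (Suc (Suc m))"

definition shifted_legendre :: "nat \<Rightarrow> real \<Rightarrow> real" where
  "shifted_legendre m x = sqrt (real (2 * m + 1)) * legendre m (2 * x - 1)"

text \<open>Multi-indices are functions \<open>'d \<Rightarrow> nat\<close>, whose order is pointwise.\<close>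

definition tensor_legendre :: "('d::finite \<Rightarrow> nat) \<Rightarrow> real ^ 'd \<Rightarrow> real" where
  "tensor_legendre m u = (\<Prod>j\<in>UNIV. shifted_legendre (m j) (u $ j))"

definition cube_measure :: "(real ^ 'd::finite) measure" where
  "cube_measure = restrict_space lborel (cbox 0 1)"

definition marginal_cdf :: "'a measure \<Rightarrow> ('a \<Rightarrow> real ^ 'd::finite) \<Rightarrow> 'd \<Rightarrow> real \<Rightarrow> real" where
  "marginal_cdf M Y j = cdf (distr M borel (\<lambda>\<omega>. Y \<omega> $ j))"

text \<open>The sign condition is needed because \<^const>\<open>ennreal\<close> truncates negative values to 0.\<close>

definition copula_density ::
    "'a measure \<Rightarrow> ('a \<Rightarrow> real ^ 'd::finite) \<Rightarrow> (real ^ 'd \<Rightarrow> real) \<Rightarrow> bool" where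
  "copula_density M Y c \<longleftrightarrow>
     c \<in> borel_measurable cube_measure \<and>
     (AE u in cube_measure. 0 \<le> c u) \<and>
     distributed M cube_measure (\<lambda>\<omega>. \<chi> j. marginal_cdf M Y j (Y \<omega> $ j)) (\<lambda>u. ennreal (c u))"

text \<open>In the following, \<open>x 0, \<dots>, x (n - 1)\<close> is the observed sample of size \<open>n\<close>.\<close>

definition empirical_cdf :: "nat \<Rightarrow> (nat \<Rightarrow> real ^ 'd::finite) \<Rightarrow> 'd \<Rightarrow> real \<Rightarrow> real" where
  "empirical_cdf n x j t = (\<Sum>i<n. of_bool (x i $ j \<le> t)) / real n"

definition copula_coeff_estimator ::
    "nat \<Rightarrow> (nat \<Rightarrow> real ^ 'd::finite) \<Rightarrow> ('d \<Rightarrow> nat) \<Rightarrow> real" where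
  "copula_coeff_estimator n x m =
     (if m = (\<lambda>_. 0) then 1
      else if card {j. m j = 0} = CARD('d) - 1 then 0
      else (\<Sum>i<n. tensor_legendre m (\<chi> j. empirical_cdf n x j (x i $ j))) / real n)"

definition copula_density_estimator ::
    "nat \<Rightarrow> ('d \<Rightarrow> nat) \<Rightarrow> (nat \<Rightarrow> real ^ 'd::finite) \<Rightarrow> real ^ 'd \<Rightarrow> real" where
  "copula_density_estimator n N x u =
     (\<Sum>m | m \<le> N. copula_coeff_estimator n x m * tensor_legendre m u)"

text \<open>A nonnegative integral is used so that divergence yields \<open>\<infinity>\<close> and not 0.\<close>

definition MISE ::
    "'a measure \<Rightarrow> (nat \<Rightarrow> 'a \<Rightarrow> real ^ 'd::finite) \<Rightarrow> (real ^ 'd \<Rightarrow> real) \<Rightarrow> nat \<Rightarrow> ('d \<Rightarrow> nat) \<Rightarrow> ennreal" where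
  "MISE M X c n N =
     (\<integral>\<^sup>+\<omega>. (\<integral>\<^sup>+u. ennreal ((copula_density_estimator n N (\<lambda>i. X i \<omega>) u - c u)\<^sup>2) \<partial>cube_measure) \<partial>M)"

end

theory Submission
  imports Defs "HOL-Computational_Algebra.Polynomial"
begin

text \<open>
  By orthonormality of the tensor Legendre polynomials \<open>T\<^sub>m\<close> the MISE is at most twice the sum of the mean
  squared errors of the estimated coefficients plus twice the squared \<open>L\<^sup>2\<close>-distance from \<open>c\<close> to
  its projection on the polynomials of multidegree at most \<open>N\<close>. The latter vanishes in the limit
  because polynomials are dense in \<open>L\<^sup>2\<close>. An estimated coefficient differs from the mean of the
  true transforms \<open>T\<^sub>m (U i)\<close> by replacing \<open>U i\<close> with its empirical version, whose mean squared
  error is \<open>O(1 / n)\<close>; since \<open>\<bar>L\<^sub>m\<bar> \<le> 1\<close> and \<open>\<bar>L'\<^sub>m\<bar> \<le> m (m + 1) / 2\<close> on \<open>[-1, 1]\<close>, the map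
  \<open>T\<^sub>m\<close> has Lipschitz constant \<open>O(K ^ (d / 2 + 2))\<close> for degrees at most \<open>K\<close>, so that each
  coefficient has mean squared error \<open>O(K ^ (d + 4) / n)\<close>, and there are at most
  \<open>(K + 1) ^ d\<close> of them.
\<close>

subsection \<open>Legendre polynomials\<close>

text \<open>Every empirical margin uses the whole sample, so the summands of an estimated
  coefficient are dependent and no cancellation between them is available. The substitution error is
  therefore bounded pathwise, by the Lipschitz estimate and Cauchy-Schwarz, which leaves only
  one-dimensional errors of the empirical distribution function. There the evaluation point belongs
  to the sample as well, so that one indicator is not centred; this costs just a constant.

  Coefficients with a single nonzero index are set to 0 by the estimator and carry no error, because
  the margins of a copula are uniform. This rests on the probability integral transform for
  distribution functions that may have flat pieces.

  Multiplying the number of coefficients by the bound for each one produces the exponent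
  \<open>2 d + 4\<close> of the growth condition. For the bias, the three-term recurrence shows that
  multiplication by a coordinate preserves the span of the \<open>T_m\<close>; hence all polynomial
  functions lie in it and the Stone-Weierstrass theorem applies.\<close>

fun legendre_poly :: "nat \<Rightarrow> real poly" where
  "legendre_poly 0 = 1"
| "legendre_poly (Suc 0) = [:0, 1:]"
| "legendre_poly (Suc (Suc m)) =
     smult (1 / real (Suc (Suc m)))
       (smult (real (2 * Suc m + 1)) ([:0, 1:] * legendre_poly (Suc m))
        - smult (real (Suc m)) (legendre_poly m))"

lemma legendre_eq_poly: "legendre m x = poly (legendre_poly m) x"
  by (induction m x rule: legendre.induct) (simp_all add: field_simps)

lemma legendre_rec:
  "real (Suc (Suc m)) * legendre (Suc (Suc m)) x =
     real (2 * m + 3) * x * legendre (Suc m) x - real (Suc m) * legendre m x"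
  by (simp add: field_simps)

text \<open>Derivatives are taken formally on the polynomial side: they exist to every order, and an
  identity between polynomials can be differentiated as it stands.\<close>

abbreviation legendre' :: "nat \<Rightarrow> real \<Rightarrow> real" where
  "legendre' m \<equiv> poly (pderiv (legendre_poly m))"

abbreviation legendre'' :: "nat \<Rightarrow> real \<Rightarrow> real" where
  "legendre'' m \<equiv> poly (pderiv (pderiv (legendre_poly m)))"

lemma DERIV_legendre: "(legendre m has_real_derivative legendre' m x) (at x)"
  using poly_DERIV[of "legendre_poly m" x] by (simp add: legendre_eq_poly[abs_def])

lemma legendre'_rec:
  "real (Suc (Suc m)) * legendre' (Suc (Suc m)) x =
     real (2 * m + 3) * (legendre (Suc m) x + x * legendre' (Suc m) x) - real (Suc m) * legendre' m x"
  by (simp add: legendre_eq_poly pderiv_smult pderiv_diff pderiv_mult pderiv_pCons field_simps)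

text \<open>The three identities need a joint induction. \<open>raise\<close> for the next degree
  comes from the differentiated recurrence and \<open>lower\<close>; the next \<open>lower\<close>
  comes from this \<open>raise\<close>, the previous \<open>weighted\<close> and the recurrence; the
  next \<open>weighted\<close> combines the two new ones.\<close>

lemma legendre'_identities:
  shows legendre'_lower: "x * legendre' (Suc m) x - legendre' m x = real (Suc m) * legendre (Suc m) x"
    and legendre'_raise: "legendre' (Suc m) x - x * legendre' m x = real (Suc m) * legendre m x"
    and legendre'_weighted:
      "(1 - x\<^sup>2) * legendre' (Suc m) x = real (Suc m) * (legendre m x - x * legendre (Suc m) x)"
proof (induction m)
  case 0
  {
    case 1 show ?case by (simp add: pderiv_pCons)
  next
    case 2 show ?case by (simp add: pderiv_pCons)
  next
    case 3 show ?case by (simp add: pderiv_pCons power2_eq_square algebra_simps)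
  }
next
  case (Suc m)
  have rec: "real (Suc (Suc m)) * legendre (Suc (Suc m)) x =
     real (2 * m + 3) * x * legendre (Suc m) x - real (Suc m) * legendre m x"
    by (rule legendre_rec)
  have cast: "real (Suc (Suc m)) = real m + 2" "real (Suc m) = real m + 1" "real (2 * m + 3) = 2 * real m + 3"
    by simp_all
  have raise: "legendre' (Suc (Suc m)) x - x * legendre' (Suc m) x
      = real (Suc (Suc m)) * legendre (Suc m) x"
  proof -
    have "real (Suc (Suc m)) * (legendre' (Suc (Suc m)) x - x * legendre' (Suc m) x
      - real (Suc (Suc m)) * legendre (Suc m) x) = 0"
      using legendre'_rec[of m x] Suc(1) unfolding cast by algebra
    thus ?thesis by (simp del: legendre_poly.simps legendre.simps)
  qed
  have lower: "x * legendre' (Suc (Suc m)) x - legendre' (Suc m) x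
      = real (Suc (Suc m)) * legendre (Suc (Suc m)) x"
    using raise Suc(3) rec unfolding cast by algebra
  {
    case 1 show ?case by (rule lower)
  next
    case 2 show ?case by (rule raise)
  next
    case 3 show ?case using raise lower by algebra
  }
qed

text \<open>Differentiating \<open>legendre'_weighted\<close> gives the second derivative together
  with a derivative of lower degree, which \<open>legendre'_lower\<close> eliminates.\<close>

lemma legendre_ode:
  "(1 - x\<^sup>2) * legendre'' m x - 2 * x * legendre' m x = - (real m * real (Suc m) * legendre m x)"
proof (cases m)
  case 0
  then show ?thesis by (simp add: pderiv_1)
next
  case (Suc k)
  let ?p = "legendre_poly (Suc k)" and ?q = "legendre_poly k"
  \<comment> \<open>The pointwise identity holds at every real argument, so it is an identity of
    polynomials and may be differentiated.\<close>
  have "(1 - [:0, 1:] * [:0, 1:]) * pderiv ?p = smult (real (Suc k)) (?q - [:0, 1:] * ?p)"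
    by (rule poly_eq_poly_eq_iff[THEN iffD1], rule ext)
      (use legendre'_weighted[of _ k] in \<open>simp add: legendre_eq_poly power2_eq_square algebra_simps
        del: legendre_poly.simps legendre.simps\<close>)
  from arg_cong[OF this, of "\<lambda>p. poly (pderiv p) x"]
  have "(1 - x\<^sup>2) * legendre'' (Suc k) x - 2 * x * legendre' (Suc k) x
      = real (Suc k) * (legendre' k x - legendre (Suc k) x - x * legendre' (Suc k) x)"
    by (simp add: pderiv_smult pderiv_diff pderiv_mult pderiv_pCons pderiv_1 legendre_eq_poly power2_eq_square
        algebra_simps del: legendre_poly.simps legendre.simps)
  also have "\<dots> = - (real (Suc k) * real (Suc (Suc k)) * legendre (Suc k) x)"
    using legendre'_lower[of x k] by (simp del: legendre_poly.simps legendre.simps) algebra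
  finally show ?thesis using Suc by simp
qed

section \<open>Uniform bounds for Legendre polynomials and their derivatives\<close>

lemma legendre_at_1 [simp]: "legendre m 1 = 1"
  by (induction m "1::real" rule: legendre.induct) (simp_all add: field_simps)

lemma legendre_at_minus_1 [simp]: "legendre m (-1) = (-1) ^ m"
  by (induction m "-1::real" rule: legendre.induct) (simp_all add: field_simps)

text \<open>Sonin's function \<open>L\<^sup>2 + (1 - x\<^sup>2) L'\<^sup>2 / (m (m + 1))\<close> has derivative
  \<open>2 x L'\<^sup>2 / (m (m + 1))\<close> by the differential equation, so its maximum is at an endpoint.\<close>

lemma abs_legendre_le_1:
  assumes "\<bar>x\<bar> \<le> 1"
  shows "\<bar>legendre m x\<bar> \<le> 1"
proof (cases "m = 0")
  case False
  define a where "a = real m * real (Suc m)"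
  have a: "a > 0" using False by (simp add: a_def)
  define f where "f x = a * (legendre m x)\<^sup>2 + (1 - x\<^sup>2) * (legendre' m x)\<^sup>2" for x
  have f': "(f has_real_derivative 2 * x * (legendre' m x)\<^sup>2) (at x)" for x
  proof -
    have D: "(legendre' m has_real_derivative legendre'' m x) (at x)"
      by (rule poly_DERIV)
    have ode: "(1 - x\<^sup>2) * legendre'' m x - 2 * x * legendre' m x = - (a * legendre m x)"
      using legendre_ode[of x m] by (simp add: a_def)
    have "(f has_real_derivative a * (2 * legendre m x * legendre' m x)
        + (- (2 * x) * (legendre' m x)\<^sup>2 + (1 - x\<^sup>2) * (2 * legendre' m x * legendre'' m x))) (at x)"
      unfolding f_def[abs_def]
      by (auto intro!: derivative_eq_intros DERIV_legendre D)
    moreover have "a * (2 * legendre m x * legendre' m x)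
        + (- (2 * x) * (legendre' m x)\<^sup>2 + (1 - x\<^sup>2) * (2 * legendre' m x * legendre'' m x))
        = 2 * x * (legendre' m x)\<^sup>2"
      using ode by algebra
    ultimately show ?thesis by (rule DERIV_cong)
  qed
  \<comment> \<open>Both endpoint values of \<open>f\<close> are \<open>a\<close>: the weight
    \<open>1 - x^2\<close> vanishes there and the square of the Legendre polynomial is 1.\<close>
  have "f x \<le> a"
  proof (cases "x \<ge> 0")
    case True
    have "f x \<le> f 1"
      by (rule DERIV_nonneg_imp_nondecreasing[of x 1 f]) (use assms True f' in \<open>force+\<close>)
    then show ?thesis by (simp add: f_def)
  next
    case False
    have "f x \<le> f (-1)"
      by (rule DERIV_nonpos_imp_nonincreasing[of "-1" x f])
        (use assms False f' in \<open>auto simp: mult_nonpos_nonneg intro!: exI conjI\<close>)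
    then show ?thesis by (simp add: f_def flip: power_mult)
  qed
  moreover have "0 \<le> (1 - x\<^sup>2) * (legendre' m x)\<^sup>2"
    using assms by (simp add: abs_square_le_1)
  ultimately have "a * (legendre m x)\<^sup>2 \<le> a * 1"
    by (simp add: f_def)
  with a have "(legendre m x)\<^sup>2 \<le> 1" by simp
  then show ?thesis by (simp add: abs_square_le_1)
qed simp

text \<open>By \<open>legendre'_raise\<close>, passing from degree \<open>m\<close> to
  \<open>m + 1\<close> adds at most \<open>m + 1\<close> to the bound, whence the triangular number;
  it is attained at \<open>x = 1\<close>.\<close>

lemma abs_legendre'_le:
  assumes "\<bar>x\<bar> \<le> 1"
  shows "\<bar>legendre' m x\<bar> \<le> real m * real (Suc m) / 2"
proof (induction m)
  case (Suc m)
  have "\<bar>legendre' (Suc m) x\<bar> = \<bar>x * legendre' m x + real (Suc m) * legendre m x\<bar>"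
    using legendre'_raise[of m x] by (simp del: legendre_poly.simps legendre.simps add: algebra_simps)
  also have "\<dots> \<le> \<bar>x\<bar> * \<bar>legendre' m x\<bar> + real (Suc m) * \<bar>legendre m x\<bar>"
    by (metis abs_mult abs_of_nat abs_triangle_ineq)
  also have "\<dots> \<le> 1 * (real m * real (Suc m) / 2) + real (Suc m) * 1"
    using assms Suc abs_legendre_le_1[OF assms] by (intro add_mono mult_mono) auto
  also have "\<dots> = real (Suc m) * real (Suc (Suc m)) / 2" by (simp add: field_simps)
  finally show ?case .
qed (simp add: pderiv_1)

lemma legendre_lipschitz:
  assumes "\<bar>x\<bar> \<le> 1" "\<bar>y\<bar> \<le> 1"
  shows "\<bar>legendre m x - legendre m y\<bar> \<le> real m * real (Suc m) / 2 * \<bar>x - y\<bar>"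
proof -
  have "norm (legendre m y - legendre m x) \<le> real m * real (Suc m) / 2 * norm (y - x)"
  proof (rule field_differentiable_bound[of "{-1..1}" "legendre m" "legendre' m"])
    fix z :: real assume "z \<in> {-1..1}"
    then have "\<bar>z\<bar> \<le> 1" by auto
    then show "norm (legendre' m z) \<le> real m * real (Suc m) / 2"
      unfolding real_norm_def by (rule abs_legendre'_le)
  qed (use assms in \<open>auto intro!: DERIV_subset[OF DERIV_legendre]\<close>)
  then show ?thesis by (simp add: abs_minus_commute)
qed

lemma continuous_on_legendre [continuous_intros]:
  "continuous_on S f \<Longrightarrow> continuous_on S (\<lambda>x. legendre m (f x))"
  unfolding legendre_eq_poly by (intro continuous_intros)

section \<open>Orthogonality and normalization\<close>

text \<open>The Sturm-Liouville argument. \<open>G\<close> is the Wronskian weighted by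
  \<open>1 - y^2\<close>; by the differential equation its derivative is the product of the two
  polynomials times the difference \<open>b\<close> of the eigenvalues, and the weight makes
  \<open>G\<close> vanish at both endpoints.\<close>

lemma legendre_orthogonal:
  assumes "m \<noteq> k"
  shows "integral {0..1} (\<lambda>x. legendre m (2 * x - 1) * legendre k (2 * x - 1)) = 0"
proof -
  define G where "G y = (1 - y\<^sup>2) * (legendre' m y * legendre k y - legendre m y * legendre' k y)" for y
  define b where "b = real k * real (Suc k) - real m * real (Suc m)"
  have "real (k * Suc k) \<noteq> real (m * Suc m)"
  proof -
    have "strict_mono (\<lambda>k::nat. k * Suc k)" by (rule strict_monoI_Suc) simp
    then show ?thesis using assms strict_mono_eq of_nat_eq_iff by metis
  qed
  then have b: "b \<noteq> 0" by (simp only: b_def of_nat_mult)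
  have G': "(G has_real_derivative b * (legendre m y * legendre k y)) (at y)" for y
  proof -
    have D: "(legendre' m has_real_derivative legendre'' m y) (at y)" for m
      by (rule poly_DERIV)
    have "(G has_real_derivative - (2 * y) * (legendre' m y * legendre k y - legendre m y * legendre' k y)
      + (1 - y\<^sup>2) * (legendre'' m y * legendre k y - legendre m y * legendre'' k y)) (at y)"
      unfolding G_def[abs_def]
      by (rule derivative_eq_intros DERIV_legendre D refl | simp add: algebra_simps)+
    moreover have "- (2 * y) * (legendre' m y * legendre k y - legendre m y * legendre' k y)
      + (1 - y\<^sup>2) * (legendre'' m y * legendre k y - legendre m y * legendre'' k y)
      = b * (legendre m y * legendre k y)"
      using legendre_ode[of y m] legendre_ode[of y k] unfolding b_def by algebra
    ultimately show ?thesis by (rule DERIV_cong)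
  qed
  have "((\<lambda>x. 2 * b * (legendre m (2 * x - 1) * legendre k (2 * x - 1)))
      has_integral G (2 * 1 - 1) - G (2 * 0 - 1)) {0..1}"
  proof (rule fundamental_theorem_of_calculus)
    fix x :: real
    have "((\<lambda>x. G (2 * x - 1)) has_real_derivative
      b * (legendre m (2 * x - 1) * legendre k (2 * x - 1)) * 2) (at x within {0..1})"
      by (rule DERIV_chain'[OF _ G']) (auto intro!: derivative_eq_intros)
    then show "((\<lambda>x. G (2 * x - 1)) has_vector_derivative
      2 * b * (legendre m (2 * x - 1) * legendre k (2 * x - 1))) (at x within {0..1})"
      by (simp add: has_real_derivative_iff_has_vector_derivative mult_ac)
  qed simp
  then have "2 * b * integral {0..1} (\<lambda>x. legendre m (2 * x - 1) * legendre k (2 * x - 1)) = 0"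
    by (simp add: G_def integral_unique flip: integral_mult_right)
  then show ?thesis using b by simp
qed

text \<open>The recurrence paired with \<open>L_n\<close>, and the one a degree lower paired with
  \<open>L_(n+1)\<close>, both lead to the moment \<open>H n (Suc n)\<close>, since orthogonality
  removes the other terms. Eliminating it yields
  \<open>(2 n + 3) J (n+1) (n+1) = (2 n + 1) J n n\<close>.\<close>

lemma integral_legendre_square:
  "integral {0..1} (\<lambda>x. (legendre m (2 * x - 1))\<^sup>2) = 1 / real (2 * m + 1)"
proof (induction m)
  case 0
  then show ?case by simp
next
  case (Suc n)
  define J where "J m k = integral {0..1} (\<lambda>x. legendre m (2 * x - 1) * legendre k (2 * x - 1))" for m k
  define H where "H m k = integral {0..1} (\<lambda>x. (2 * x - 1) * (legendre m (2 * x - 1) * legendre k (2 * x - 1)))" for m k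
  have rec: "real (Suc (Suc m)) * J (Suc (Suc m)) k = real (2 * m + 3) * H (Suc m) k - real (Suc m) * J m k" for m k
  proof -
    have "(\<lambda>x. real (Suc (Suc m)) * (legendre (Suc (Suc m)) (2 * x - 1) * legendre k (2 * x - 1))) =
      (\<lambda>x. real (2 * m + 3) * ((2 * x - 1) * (legendre (Suc m) (2 * x - 1) * legendre k (2 * x - 1)))
        - real (Suc m) * (legendre m (2 * x - 1) * legendre k (2 * x - 1)))"
      (is "?f = ?g")
    proof
      fix x :: real
      show "?f x = ?g x"
        using legendre_rec[of m "2 * x - 1"] by algebra
    qed
    then have "integral {0..1} ?f = integral {0..1} ?g" by simp
    also have "integral {0..1} ?g =
      integral {0..1} (\<lambda>x. real (2 * m + 3) * ((2 * x - 1) * (legendre (Suc m) (2 * x - 1) * legendre k (2 * x - 1))))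
       - integral {0..1} (\<lambda>x. real (Suc m) * (legendre m (2 * x - 1) * legendre k (2 * x - 1)))"
      by (intro integral_diff integrable_continuous_real continuous_intros)
    finally show ?thesis by (simp only: integral_mult_right J_def H_def)
  qed
  have H: "H m k = H k m" for m k by (simp add: H_def mult_ac)
  have orth: "J m k = 0" if "m \<noteq> k" for m k using legendre_orthogonal[OF that] by (simp add: J_def)
  have IH: "J n n = 1 / real (2 * n + 1)" using Suc by (simp add: J_def power2_eq_square)
  have "J (Suc n) (Suc n) = 1 / real (2 * Suc n + 1)"
  proof -
    have e1: "real (2 * n + 3) * H n (Suc n) = real (Suc n) * J n n"
      using rec[of n n] orth[of "Suc (Suc n)" n] H by simp
    \<comment> \<open>For \<open>n = 0\<close> there is no lower recurrence to use, but
      \<open>L_1(y) = y\<close> makes both sides the same integral.\<close>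
    have e2: "real (Suc n) * J (Suc n) (Suc n) = real (2 * n + 1) * H n (Suc n)"
    proof (cases n)
      case 0
      then show ?thesis by (simp add: J_def H_def)
    next
      case (Suc p)
      then show ?thesis using rec[of p "Suc n"] orth[of p "Suc n"] by simp
    qed
    have "real (Suc n) * (real (2 * n + 3) * J (Suc n) (Suc n))
       = real (2 * n + 1) * (real (Suc n) * J n n)"
      using e1 e2 by algebra
    then have "real (2 * n + 3) * J (Suc n) (Suc n) = real (2 * n + 1) * J n n"
      by (simp del: of_nat_Suc of_nat_add)
    then show ?thesis using IH by (simp add: field_simps)
  qed
  then show ?case by (simp add: J_def power2_eq_square)
qed

lemma continuous_on_shifted_legendre [continuous_intros]:
  "continuous_on S f \<Longrightarrow> continuous_on S (\<lambda>x. shifted_legendre m (f x))"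
  unfolding shifted_legendre_def by (intro continuous_intros)

lemma borel_measurable_shifted_legendre [measurable]: "shifted_legendre m \<in> borel_measurable borel"
  by (intro borel_measurable_continuous_onI continuous_intros)

lemma shifted_legendre_0 [simp]: "shifted_legendre 0 x = 1"
  by (simp add: shifted_legendre_def)

lemma shifted_legendre_orthonormal:
  "integral {0..1} (\<lambda>x. shifted_legendre m x * shifted_legendre k x) = of_bool (m = k)"
proof -
  have "integral {0..1} (\<lambda>x. shifted_legendre m x * shifted_legendre k x)
    = sqrt (real (2 * m + 1)) * sqrt (real (2 * k + 1)) *
      integral {0..1} (\<lambda>x. legendre m (2 * x - 1) * legendre k (2 * x - 1))"
    unfolding integral_mult_right[symmetric] by (simp add: shifted_legendre_def mult_ac)
  then show ?thesis
    using legendre_orthogonal[of m k] integral_legendre_square[of m]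
    by (cases "m = k") (simp_all add: power2_eq_square)
qed

text \<open>The three-term recurrence solved for its middle term; the affine change of argument
  contributes the term of degree \<open>m\<close>. For \<open>m = 0\<close> the truncated
  \<open>m - 1\<close> does no harm because its coefficient is chosen to be 0.\<close>

lemma shifted_legendre_times_arg:
  "\<exists>a b c. \<forall>x. x * shifted_legendre m x =
     a * shifted_legendre (Suc m) x + b * shifted_legendre m x + c * shifted_legendre (m - 1) x"
proof -
  have "\<exists>a c. \<forall>y. y * legendre m y = a * legendre (Suc m) y + c * legendre (m - 1) y"
  proof (cases m)
    case 0
    show ?thesis by (rule exI[of _ 1], rule exI[of _ 0]) (simp add: 0)
  next
    case (Suc p)
    have "y * legendre m y = real (p + 2) / real (2 * p + 3) * legendre (Suc m) y
        + real (p + 1) / real (2 * p + 3) * legendre (m - 1) y" for y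
    proof -
      have "real (2 * p + 3) * (y * legendre m y)
          = real (p + 2) * legendre (Suc m) y + real (p + 1) * legendre (m - 1) y"
        using legendre_rec[of p y] by (simp add: Suc del: legendre.simps)
      then have "y * legendre m y
          = (real (p + 2) * legendre (Suc m) y + real (p + 1) * legendre (m - 1) y) / real (2 * p + 3)"
        by (simp add: eq_divide_eq mult.commute)
      then show ?thesis by (simp only: add_divide_distrib times_divide_eq_left)
    qed
    then show ?thesis by blast
  qed
  then obtain a c where ac: "\<And>y. y * legendre m y = a * legendre (Suc m) y + c * legendre (m - 1) y"
    by blast
  define r where "r m = sqrt (real (2 * m + 1))" for m
  have r: "r m \<noteq> 0" for m by (simp add: r_def)
  have "x * shifted_legendre m x = (r m * a / 2 / r (Suc m)) * shifted_legendre (Suc m) x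
    + (1 / 2) * shifted_legendre m x + (r m * c / 2 / r (m - 1)) * shifted_legendre (m - 1) x" for x
  proof -
    have "x * shifted_legendre m x = r m * ((2 * x - 1) * legendre m (2 * x - 1) + legendre m (2 * x - 1)) / 2"
      by (simp add: shifted_legendre_def r_def field_simps)
    also have "\<dots> = r m * a / 2 * legendre (Suc m) (2 * x - 1) + (1 / 2) * (r m * legendre m (2 * x - 1))
      + r m * c / 2 * legendre (m - 1) (2 * x - 1)"
      unfolding ac by (simp add: algebra_simps add_divide_distrib)
    finally show ?thesis using r by (simp add: shifted_legendre_def r_def)
  qed
  then show ?thesis by blast
qed

subsection \<open>Legendre expansions on the unit cube\<close>

lemma space_cube_measure [simp]: "space cube_measure = cbox 0 1"
  by (simp add: cube_measure_def space_restrict_space)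

lemma continuous_on_tensor_legendre: "continuous_on S (tensor_legendre m)"
  unfolding tensor_legendre_def[abs_def] by (intro continuous_intros)

lemma measurable_cube_measureI: 
  "f \<in> borel_measurable borel \<Longrightarrow> f \<in> borel_measurable (cube_measure :: (real ^ 'd::finite) measure)"
  unfolding cube_measure_def by (rule measurable_restrict_space1) simp

lemma borel_measurable_tensor_legendre [measurable]:
  "tensor_legendre m \<in> borel_measurable borel"
  by (intro borel_measurable_continuous_onI continuous_on_tensor_legendre)

lemma prob_space_cube_measure: "prob_space (cube_measure :: (real ^ 'd::finite) measure)"
proof
  have "emeasure lborel (cbox 0 1 :: (real ^ 'd) set) = 1"
  proof -
    have "(1 :: real ^ 'd) \<bullet> b = 1" if "b \<in> Basis" for b
      using that by (auto simp: Basis_vec_def inner_axis)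
    then show ?thesis by (simp add: emeasure_lborel_cbox_eq)
  qed
  then show "emeasure cube_measure (space (cube_measure :: (real ^ 'd) measure)) = 1"
    unfolding cube_measure_def by (simp add: emeasure_restrict_space space_restrict_space)
qed

interpretation cube: prob_space "cube_measure :: (real ^ 'd::finite) measure"
  by (rule prob_space_cube_measure)

lemma integrable_cube_continuous:
  fixes f :: "real ^ 'd::finite \<Rightarrow> real"
  assumes "continuous_on (cbox 0 1) f"
  shows "integrable cube_measure f"
  unfolding cube_measure_def
  using borel_integrable_compact[OF compact_cbox assms] by (subst integrable_restrict_space) simp_all

text \<open>Fubini for product integrands. Each factor is cut off to \<open>[0, 1]\<close> first, so
  that the indicator of the cube factorizes too; then Lebesgue measure is the image of the product
  measure over the coordinate axes.\<close>

lemma integral_cube_prod: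
  fixes g :: "'d::finite \<Rightarrow> real \<Rightarrow> real"
  assumes g: "\<And>j. continuous_on UNIV (g j)"
  shows "(\<integral>u. (\<Prod>j\<in>UNIV. g j (u $ j)) \<partial>cube_measure) = (\<Prod>j\<in>UNIV. integral {0..1} (g j))"
proof -
  define h where "h j x = indicator {0..1} x * g j x" for j :: 'd and x :: real
  have h_int: "integrable lborel (h j)" for j
    using borel_integrable_compact[OF compact_Icc continuous_on_subset[OF g[of j] subset_UNIV], of 0 1]
    by (simp add: h_def[abs_def])
  have g_meas[measurable]: "g j \<in> borel_measurable borel" for j
    by (rule borel_measurable_continuous_onI[OF g])
  have h_meas[measurable]: "h j \<in> borel_measurable borel" for j
    unfolding h_def[abs_def] by measurable
  have h_integral: "integral\<^sup>L lborel (h j) = integral {0..1} (g j)" for j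
  proof -
    have "integral\<^sup>L lborel (h j) = integral UNIV (h j)" by (rule integral_lborel[OF h_int, symmetric])
    also have "\<dots> = integral UNIV (\<lambda>x. if x \<in> {0..1} then g j x else 0)"
      by (intro arg_cong[where f = "integral UNIV"]) (auto simp: h_def fun_eq_iff)
    finally show ?thesis by (simp only: integral_restrict_UNIV)
  qed
  have Basis: "(Basis :: (real ^ 'd) set) = range (\<lambda>j. axis j 1)"
    by (auto simp: Basis_vec_def)
  have inj: "inj (\<lambda>j::'d. axis j (1::real))"
    by (auto simp: inj_def axis_eq_axis)
  interpret product_sigma_finite "\<lambda>_::real^'d. lborel :: real measure" by standard
  have "(\<integral>u. (\<Prod>j\<in>UNIV. g j (u $ j)) \<partial>cube_measure) = (\<integral>u. (\<Prod>j\<in>UNIV. h j (u $ j)) \<partial>lborel)"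
  proof -
    have "indicator (cbox 0 1) u * (\<Prod>j\<in>UNIV. g j (u $ j)) = (\<Prod>j\<in>UNIV. h j (u $ j))" for u :: "real ^ 'd"
      by (auto simp: h_def indicator_def mem_box_cart intro!: prod.cong)
    then show ?thesis
      unfolding cube_measure_def by (subst integral_restrict_space) simp_all
  qed
  also have "\<dots> = (\<integral>f. (\<Prod>j\<in>UNIV. h j ((\<Sum>b\<in>Basis. f b *\<^sub>R b) $ j)) \<partial>(\<Pi>\<^sub>M b\<in>(Basis :: (real ^ 'd) set). lborel))"
    by (subst lborel_eq, subst integral_distr) simp_all
  also have "\<dots> = (\<integral>f. (\<Prod>b\<in>Basis. h (axis_index b) (f b)) \<partial>(\<Pi>\<^sub>M b\<in>(Basis :: (real ^ 'd) set). lborel))"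
  proof (rule arg_cong[where f = "integral\<^sup>L _"], rule ext)
    fix f :: "real ^ 'd \<Rightarrow> real"
    have "(\<Sum>b\<in>Basis. f b *\<^sub>R b) $ j = f (axis j 1)" for j :: 'd
      unfolding Basis by (subst sum.reindex[OF inj]) (simp add: axis_def if_distrib[of "\<lambda>x. _ * x"] cong: if_cong)
    then show "(\<Prod>j\<in>UNIV. h j ((\<Sum>b\<in>Basis. f b *\<^sub>R b) $ j)) = (\<Prod>b\<in>Basis. h (axis_index b) (f b))"
      unfolding Basis by (subst prod.reindex[OF inj]) (simp add: axis_index_axis)
  qed
  also have "\<dots> = (\<Prod>b\<in>(Basis :: (real ^ 'd) set). integral\<^sup>L lborel (h (axis_index b)))"
    by (rule product_integral_prod) (simp_all add: h_int)
  also have "\<dots> = (\<Prod>j\<in>UNIV. integral {0..1} (g j))"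
    unfolding Basis by (subst prod.reindex[OF inj]) (simp add: axis_index_axis h_integral)
  finally show ?thesis .
qed

lemma tensor_legendre_orthonormal:
  "(\<integral>u. tensor_legendre m u * tensor_legendre k u \<partial>cube_measure) = of_bool (m = k)"
proof -
  have "(\<integral>u. tensor_legendre m u * tensor_legendre k u \<partial>cube_measure)
      = (\<Prod>j\<in>UNIV. integral {0..1} (\<lambda>x. shifted_legendre (m j) x * shifted_legendre (k j) x))"
    unfolding tensor_legendre_def prod.distrib[symmetric]
    by (rule integral_cube_prod) (intro continuous_intros)
  also have "\<dots> = of_bool (m = k)"
    by (auto simp: shifted_legendre_orthonormal fun_eq_iff)
  finally show ?thesis .
qed

lemma finite_multi_index [simp]: "finite {m :: 'd::finite \<Rightarrow> nat. m \<le> N}"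
proof (rule finite_subset)
  show "{m. m \<le> N} \<subseteq> (\<Pi>\<^sub>E j\<in>UNIV. {..N j})" by (auto simp: le_fun_def)
qed (auto intro: finite_PiE)

lemma integrable_mult_squares:
  fixes f g :: "'a \<Rightarrow> real"
  assumes [measurable]: "f \<in> borel_measurable M" "g \<in> borel_measurable M"
    and "integrable M (\<lambda>x. (f x)\<^sup>2)" "integrable M (\<lambda>x. (g x)\<^sup>2)"
  shows "integrable M (\<lambda>x. f x * g x)"
proof (rule Bochner_Integration.integrable_bound)
  show "integrable M (\<lambda>x. (f x)\<^sup>2 + (g x)\<^sup>2)" using assms by simp
  have "\<bar>a * b\<bar> \<le> a\<^sup>2 + b\<^sup>2" for a b :: real
    using sum_squares_bound[of "\<bar>a\<bar>" "\<bar>b\<bar>"] mult_nonneg_nonneg[of "\<bar>a\<bar>" "\<bar>b\<bar>"]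
    by (simp add: abs_mult mult.assoc del: mult_nonneg_nonneg)
  then show "AE x in M. norm (f x * g x) \<le> norm ((f x)\<^sup>2 + (g x)\<^sup>2)" by simp
qed measurable

lemma integrable_diff_square:
  fixes f g :: "'a \<Rightarrow> real"
  assumes "f \<in> borel_measurable M" "g \<in> borel_measurable M"
    and "integrable M (\<lambda>x. (f x)\<^sup>2)" "integrable M (\<lambda>x. (g x)\<^sup>2)"
  shows "integrable M (\<lambda>x. (f x - g x)\<^sup>2)"
  using integrable_mult_squares[OF assms] assms(3,4)
  by (simp add: power2_diff mult.assoc)

lemma integral_legendre_sum_square:
  assumes "finite A"
  shows "(\<integral>u. (\<Sum>m\<in>A. a m * tensor_legendre m u)\<^sup>2 \<partial>cube_measure) = (\<Sum>m\<in>A. (a m)\<^sup>2)"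
proof -
  have int: "integrable cube_measure (\<lambda>u. tensor_legendre m u * tensor_legendre k u)" for m k :: "'a \<Rightarrow> nat"
    by (intro integrable_cube_continuous continuous_intros continuous_on_tensor_legendre)
  have "(\<integral>u. (\<Sum>m\<in>A. a m * tensor_legendre m u)\<^sup>2 \<partial>cube_measure)
     = (\<integral>u. (\<Sum>m\<in>A. \<Sum>k\<in>A. a m * a k * (tensor_legendre m u * tensor_legendre k u)) \<partial>cube_measure)"
    by (simp add: power2_eq_square sum_product mult_ac)
  also have "\<dots> = (\<Sum>m\<in>A. \<Sum>k\<in>A. a m * a k * of_bool (m = k))"
    by (simp add: int tensor_legendre_orthonormal Bochner_Integration.integral_sum
        del: of_bool_eq_iff)
  also have "\<dots> = (\<Sum>m\<in>A. \<Sum>k\<in>A. if m = k then (a m)\<^sup>2 else 0)"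
    by (intro sum.cong refl) (auto simp: power2_eq_square)
  also have "\<dots> = (\<Sum>m\<in>A. (a m)\<^sup>2)" using assms by simp
  finally show ?thesis .
qed

section \<open>Orthogonal projection and Bessel's inequality\<close>

definition legendre_coeff :: "(real ^ 'd::finite \<Rightarrow> real) \<Rightarrow> ('d \<Rightarrow> nat) \<Rightarrow> real" where
  "legendre_coeff f m = (\<integral>u. f u * tensor_legendre m u \<partial>cube_measure)"

definition legendre_proj :: "('d::finite \<Rightarrow> nat) \<Rightarrow> (real ^ 'd \<Rightarrow> real) \<Rightarrow> real ^ 'd \<Rightarrow> real" where
  "legendre_proj N f u = (\<Sum>m | m \<le> N. legendre_coeff f m * tensor_legendre m u)"

lemma continuous_on_legendre_proj: "continuous_on S (legendre_proj N f)"
  unfolding legendre_proj_def[abs_def] by (intro continuous_intros continuous_on_tensor_legendre)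

lemma integrable_mult_tensor_legendre:
  assumes "f \<in> borel_measurable cube_measure" "integrable cube_measure (\<lambda>u. (f u)\<^sup>2)"
  shows "integrable cube_measure (\<lambda>u. f u * tensor_legendre m u)"
proof (rule integrable_mult_squares[OF assms(1) _ assms(2)])
  show "tensor_legendre m \<in> borel_measurable cube_measure"
    by (rule measurable_cube_measureI) simp
  show "integrable cube_measure (\<lambda>u. (tensor_legendre m u)\<^sup>2)"
    by (intro integrable_cube_continuous continuous_intros continuous_on_tensor_legendre)
qed

text \<open>Pythagoras: the integral of \<open>f\<close> times its projection equals the squared
  norm of the projection, so the residual has squared norm that of \<open>f\<close> minus the sum of
  the squared coefficients.\<close>

lemma bessel:
  fixes f :: "real ^ 'd::finite \<Rightarrow> real"
  assumes f: "f \<in> borel_measurable cube_measure" "integrable cube_measure (\<lambda>u. (f u)\<^sup>2)"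
  shows "(\<integral>u. (f u - legendre_proj N f u)\<^sup>2 \<partial>cube_measure) \<le> (\<integral>u. (f u)\<^sup>2 \<partial>cube_measure)"
proof -
  let ?A = "{m. m \<le> N}"
  note int = integrable_mult_tensor_legendre[OF f]
  have P: "integrable cube_measure (\<lambda>u. (legendre_proj N f u)\<^sup>2)"
    by (intro integrable_cube_continuous continuous_intros continuous_on_legendre_proj)
  have fP: "f u * legendre_proj N f u = (\<Sum>m\<in>?A. legendre_coeff f m * (f u * tensor_legendre m u))" for u
    by (simp add: legendre_proj_def sum_distrib_left mult_ac)
  have fP_int: "integrable cube_measure (\<lambda>u. f u * legendre_proj N f u)"
    unfolding fP by (intro Bochner_Integration.integrable_sum integrable_mult_right int)
  have "(\<integral>u. f u * legendre_proj N f u \<partial>cube_measure) = (\<Sum>m\<in>?A. (legendre_coeff f m)\<^sup>2)"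
    unfolding fP by (subst Bochner_Integration.integral_sum)
      (simp_all add: int power2_eq_square flip: legendre_coeff_def)
  moreover have "(\<integral>u. (legendre_proj N f u)\<^sup>2 \<partial>cube_measure) = (\<Sum>m\<in>?A. (legendre_coeff f m)\<^sup>2)"
    unfolding legendre_proj_def by (rule integral_legendre_sum_square) simp
  moreover have "(\<integral>u. (f u - legendre_proj N f u)\<^sup>2 \<partial>cube_measure)
     = (\<integral>u. (f u)\<^sup>2 \<partial>cube_measure) + (\<integral>u. (legendre_proj N f u)\<^sup>2 \<partial>cube_measure)
       - 2 * (\<integral>u. f u * legendre_proj N f u \<partial>cube_measure)"
    using f P fP_int by (simp add: power2_diff mult.assoc)
  moreover have "0 \<le> (\<Sum>m\<in>?A. (legendre_coeff f m)\<^sup>2)" by (intro sum_nonneg) simp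
  ultimately show ?thesis by linarith
qed

section \<open>Polynomial functions as combinations of tensor Legendre polynomials\<close>

inductive_set legendre_span :: "(real ^ 'd::finite \<Rightarrow> real) set" where
  base: "tensor_legendre m \<in> legendre_span"
| cmult: "f \<in> legendre_span \<Longrightarrow> (\<lambda>u. a * f u) \<in> legendre_span"
| add: "f \<in> legendre_span \<Longrightarrow> g \<in> legendre_span \<Longrightarrow> (\<lambda>u. f u + g u) \<in> legendre_span"

lemma legendre_span_sum:
  "finite A \<Longrightarrow> (\<And>i. i \<in> A \<Longrightarrow> f i \<in> legendre_span) \<Longrightarrow> (\<lambda>u. \<Sum>i\<in>A. f i u) \<in> legendre_span"
proof (induction A rule: finite_induct)
  case empty
  show ?case using cmult[OF base, of 0] by simp
next
  case (insert i A)
  then show ?case using add[of "f i" "\<lambda>u. \<Sum>i\<in>A. f i u"] by simp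
qed

lemma continuous_on_legendre_span: "f \<in> legendre_span \<Longrightarrow> continuous_on S f"
  by (induction rule: legendre_span.induct) (auto intro!: continuous_intros continuous_on_tensor_legendre)

lemma legendre_span_times_coord:
  "f \<in> legendre_span \<Longrightarrow> (\<lambda>u. u $ j * f u) \<in> legendre_span"
proof (induction rule: legendre_span.induct)
  case (base m)
  obtain a b c where abc: "\<And>x. x * shifted_legendre (m j) x =
     a * shifted_legendre (Suc (m j)) x + b * shifted_legendre (m j) x + c * shifted_legendre (m j - 1) x"
    using shifted_legendre_times_arg by blast
  \<comment> \<open>Multiplication by coordinate \<open>j\<close> affects only factor
    \<open>j\<close>, to which the one-dimensional recurrence applies; \<open>R\<close> collects the
    untouched factors. The update \<open>m(j := m j)\<close> is \<open>m\<close> itself, written so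
    that all three terms split in the same way.\<close>
  define R where "R u = (\<Prod>i\<in>UNIV - {j}. shifted_legendre (m i) (u $ i))" for u :: "real ^ 'a"
  have split: "tensor_legendre (m(j := k)) u = shifted_legendre k (u $ j) * R u" for k u
    by (simp add: tensor_legendre_def R_def prod.remove[of UNIV j])
  have "(\<lambda>u. u $ j * tensor_legendre m u) = (\<lambda>u. a * tensor_legendre (m(j := Suc (m j))) u
      + b * tensor_legendre (m(j := m j)) u + c * tensor_legendre (m(j := m j - 1)) u)"
  proof
    fix u
    have "u $ j * tensor_legendre m u = (u $ j * shifted_legendre (m j) (u $ j)) * R u"
      using split[of "m j" u] by simp
    then show "u $ j * tensor_legendre m u = a * tensor_legendre (m(j := Suc (m j))) u
      + b * tensor_legendre (m(j := m j)) u + c * tensor_legendre (m(j := m j - 1)) u"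
      unfolding split abc by (simp add: algebra_simps)
  qed
  also have "\<dots> \<in> legendre_span"
    by (intro legendre_span.intros)
  finally show ?case .
next
  case (cmult f a)
  then show ?case using legendre_span.cmult[OF cmult.IH, of a] by (simp add: mult_ac)
next
  case (add f g)
  then show ?case using legendre_span.add[OF add.IH] by (simp add: algebra_simps)
qed

text \<open>Keeping the multiplier \<open>f\<close> arbitrary carries the induction through
  products: \<open>(p q) f\<close> is \<open>p\<close> applied to the span element
  \<open>q f\<close>. A linear function reduces to its values on the axes and multiplication by
  coordinates.\<close>

lemma legendre_span_times_polynomial:
  fixes p :: "real ^ 'd::finite \<Rightarrow> real"
  assumes "real_polynomial_function p" "f \<in> legendre_span"
  shows "(\<lambda>u. p u * f u) \<in> legendre_span"
  using assms
proof (induction p arbitrary: f rule: real_polynomial_function.induct)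
  case (linear h)
  have h: "h u = (\<Sum>j\<in>UNIV. h (axis j 1) * u $ j)" for u
  proof -
    have "h u = h (\<Sum>j\<in>UNIV. (u $ j) *\<^sub>R axis j 1)"
      by (subst basis_expansion[symmetric]) (simp add: scalar_mult_eq_scaleR)
    also have "\<dots> = (\<Sum>j\<in>UNIV. (u $ j) *\<^sub>R h (axis j 1))"
      using bounded_linear.linear[OF linear(1)] by (simp only: linear_sum linear_scale)
    finally show ?thesis by (simp add: mult.commute)
  qed
  have "(\<lambda>u. h u * f u) = (\<lambda>u. \<Sum>j\<in>UNIV. h (axis j 1) * (u $ j * f u))"
    by (rule ext, subst h) (simp add: sum_distrib_right mult.assoc)
  also have "\<dots> \<in> legendre_span"
    by (intro legendre_span_sum cmult legendre_span_times_coord linear) simp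
  finally show ?case .
next
  case (const c)
  then show ?case by (rule cmult)
next
  case (add p q)
  then show ?case using legendre_span.add[OF add.IH(1) add.IH(2), of f f] by (simp add: algebra_simps)
next
  case (mult p q)
  then show ?case by (simp add: mult.assoc)
qed

lemma polynomial_in_legendre_span:
  assumes "real_polynomial_function p"
  shows "p \<in> legendre_span"
proof -
  have "(\<lambda>u. p u * tensor_legendre (\<lambda>_. 0) u) \<in> legendre_span"
    by (intro legendre_span_times_polynomial assms base)
  then show ?thesis by (simp add: tensor_legendre_def)
qed

text \<open>By orthonormality a projection reproduces \<open>T_m\<close> once its range of indices
  contains \<open>m\<close>, and a combination once the range contains all indices involved. The
  threshold must hold in every coordinate, as the order on multi-indices is componentwise.\<close>

lemma legendre_proj_span:
  "f \<in> legendre_span \<Longrightarrow> \<exists>K. \<forall>N. (\<forall>j. K \<le> N j) \<longrightarrow> legendre_proj N f = f"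
proof (induction rule: legendre_span.induct)
  case (base m)
  show ?case
  proof (intro exI allI impI ext)
    fix N :: "'a \<Rightarrow> nat" and u :: "real ^ 'a"
    assume "\<forall>j. Max (range m) \<le> N j"
    then have "m \<le> N" by (auto simp: le_fun_def)
    then show "legendre_proj N (tensor_legendre m) u = tensor_legendre m u"
      by (simp add: legendre_proj_def legendre_coeff_def tensor_legendre_orthonormal)
  qed
next
  case (cmult f a)
  then show ?case
    by (auto simp: legendre_proj_def legendre_coeff_def mult.assoc fun_eq_iff simp flip: sum_distrib_left)
next
  case (add f g)
  then obtain K L where K: "\<And>N. \<forall>j. K \<le> N j \<Longrightarrow> legendre_proj N f = f"
    and L: "\<And>N. \<forall>j. L \<le> N j \<Longrightarrow> legendre_proj N g = g" by blast
  have "legendre_proj N (\<lambda>u. f u + g u) = (\<lambda>u. legendre_proj N f u + legendre_proj N g u)" for N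
  proof -
    have "integrable cube_measure (\<lambda>u. h u * tensor_legendre m u)" if "h \<in> legendre_span" for h m
      by (intro integrable_cube_continuous continuous_intros continuous_on_tensor_legendre
          continuous_on_legendre_span that)
    from this[OF add.hyps(1)] this[OF add.hyps(2)] show ?thesis
      by (simp add: legendre_proj_def legendre_coeff_def distrib_right sum.distrib fun_eq_iff)
  qed
  then have "\<forall>N. (\<forall>j. max K L \<le> N j) \<longrightarrow> legendre_proj N (\<lambda>u. f u + g u) = (\<lambda>u. f u + g u)"
    using K L by simp
  then show ?case by blast
qed

text \<open>The projection fixes \<open>f\<close>, so \<open>c\<close> and \<open>c - f\<close> have
  the same residual; Bessel's inequality for \<open>c - f\<close> bounds it.\<close>

lemma legendre_proj_best_approx:
  fixes c :: "real ^ 'd::finite \<Rightarrow> real"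
  assumes c: "c \<in> borel_measurable cube_measure" "integrable cube_measure (\<lambda>u. (c u)\<^sup>2)"
    and f: "f \<in> legendre_span" "legendre_proj N f = f"
  shows "(\<integral>u. (c u - legendre_proj N c u)\<^sup>2 \<partial>cube_measure) \<le> (\<integral>u. (c u - f u)\<^sup>2 \<partial>cube_measure)"
proof -
  have cont: "continuous_on S f" for S by (rule continuous_on_legendre_span[OF f(1)])
  have f_meas: "f \<in> borel_measurable cube_measure"
    by (intro measurable_cube_measureI borel_measurable_continuous_onI cont)
  have f_sq: "integrable cube_measure (\<lambda>u. (f u)\<^sup>2)"
    by (intro integrable_cube_continuous continuous_intros cont)
  have "legendre_proj N (\<lambda>u. c u - f u) u = legendre_proj N c u - legendre_proj N f u" for u
    using integrable_mult_tensor_legendre[OF c] integrable_mult_tensor_legendre[OF f_meas f_sq]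
    by (simp add: legendre_proj_def legendre_coeff_def left_diff_distrib sum_subtractf)
  then have eq: "c u - legendre_proj N c u = (c u - f u) - legendre_proj N (\<lambda>u. c u - f u) u" for u
    using f(2) by simp
  show ?thesis
    unfolding eq
    by (rule bessel) (use c(1) f_meas integrable_diff_square[OF c(1) f_meas c(2) f_sq] in simp_all)
qed

section \<open>Density in L2 by truncation and Stone-Weierstrass\<close>

abbreviation clamp_real :: "real \<Rightarrow> real \<Rightarrow> real" where
  "clamp_real B y \<equiv> max (- B) (min B y)"

lemma AE_cube_measureI:
  assumes "negligible S" "\<And>u. u \<in> cbox 0 1 \<Longrightarrow> u \<notin> S \<Longrightarrow> P u"
  shows "AE u in (cube_measure :: (real ^ 'd::finite) measure). P u"
proof -
  have "AE u in lebesgue. u \<notin> S"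
    using assms(1) by (intro AE_not_in) (simp add: negligible_iff_null_sets)
  then have "AE u in lborel. u \<notin> S" by (simp add: AE_completion_iff)
  then show ?thesis
    unfolding cube_measure_def using assms(2) by (subst AE_restrict_space_iff) auto
qed

text \<open>The notion \<open>measurable_on\<close> means being a limit of continuous functions off
  a negligible set. As \<open>c\<close> is controlled only on the cube, it is extended by 0 before
  passing to this notion.\<close>

lemma cube_measurable_ae_limit_continuous:
  fixes c :: "real ^ 'd::finite \<Rightarrow> real"
  assumes "c \<in> borel_measurable cube_measure"
  obtains g where "\<And>n. continuous_on UNIV (g n)" "AE u in cube_measure. (\<lambda>n. g n u) \<longlonglongrightarrow> c u"
proof -
  have "(\<lambda>u. indicator (cbox 0 1) u *\<^sub>R c u) \<in> borel_measurable lborel"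
    using assms unfolding cube_measure_def by (subst (asm) borel_measurable_restrict_space_iff) simp_all
  then have "(\<lambda>u. indicator (cbox 0 1) u *\<^sub>R c u) measurable_on UNIV"
    by (intro lebesgue_measurable_imp_measurable_on measurable_completion) auto
  then obtain S g where "negligible S" "\<And>n. continuous_on UNIV (g n)"
    and lim: "\<And>u. u \<notin> S \<Longrightarrow> (\<lambda>n. g n u) \<longlonglongrightarrow> indicator (cbox 0 1) u *\<^sub>R c u"
    unfolding measurable_on_def by auto
  moreover have "AE u in cube_measure. (\<lambda>n. g n u) \<longlonglongrightarrow> c u"
    by (rule AE_cube_measureI[OF \<open>negligible S\<close>]) (use lim in fastforce)
  ultimately show thesis using that by blast
qed

lemma clamp_real_L2_tendsto:
  assumes c: "c \<in> borel_measurable M" "integrable M (\<lambda>u. (c u)\<^sup>2)"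
  shows "(\<lambda>n. \<integral>u. (c u - clamp_real (real n) (c u))\<^sup>2 \<partial>M) \<longlonglongrightarrow> 0"
proof -
  note c(1)[measurable]
  have "(\<lambda>n. \<integral>u. (c u - clamp_real (real n) (c u))\<^sup>2 \<partial>M) \<longlonglongrightarrow> (\<integral>u. 0 \<partial>M)"
  proof (rule integral_dominated_convergence[where w = "\<lambda>u. (c u)\<^sup>2"])
    show "AE u in M. (\<lambda>n. (c u - clamp_real (real n) (c u))\<^sup>2) \<longlonglongrightarrow> 0"
    proof (intro AE_I2 tendsto_eventually eventually_sequentiallyI)
      fix u n assume "nat \<lceil>\<bar>c u\<bar>\<rceil> \<le> n"
      then have "\<bar>c u\<bar> \<le> real n" by linarith
      then show "(c u - clamp_real (real n) (c u))\<^sup>2 = 0" by (auto simp: min_def max_def abs_if split: if_splits)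
    qed
    show "AE u in M. norm ((c u - clamp_real (real n) (c u))\<^sup>2) \<le> (c u)\<^sup>2" for n
    proof (rule AE_I2)
      fix u
      have "\<bar>c u - clamp_real (real n) (c u)\<bar> \<le> \<bar>c u\<bar>" by (auto simp: min_def max_def abs_if)
      then show "norm ((c u - clamp_real (real n) (c u))\<^sup>2) \<le> (c u)\<^sup>2"
        by (simp add: abs_le_square_iff)
    qed
  qed (use c in simp_all)
  then show ?thesis by simp
qed

text \<open>Almost everywhere convergence does not by itself give convergence in L2; truncation at a
  fixed level provides the dominating constant \<open>(2 * B)^2\<close>, integrable because the
  total mass is 1.\<close>

lemma clamp_real_ae_L2_tendsto:
  assumes "prob_space M"
    and [measurable]: "c \<in> borel_measurable M" "\<And>n. g n \<in> borel_measurable M"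
    and lim: "AE u in M. (\<lambda>n::nat. g n u) \<longlonglongrightarrow> c u"
    and "B \<ge> 0"
  shows "(\<lambda>n. \<integral>u. (clamp_real B (c u) - clamp_real B (g n u))\<^sup>2 \<partial>M) \<longlonglongrightarrow> 0"
proof -
  interpret prob_space M by fact
  have "(\<lambda>n. \<integral>u. (clamp_real B (c u) - clamp_real B (g n u))\<^sup>2 \<partial>M) \<longlonglongrightarrow> (\<integral>u. 0 \<partial>M)"
  proof (rule integral_dominated_convergence[where w = "\<lambda>u. (2 * B)\<^sup>2"])
    show "AE u in M. (\<lambda>n. (clamp_real B (c u) - clamp_real B (g n u))\<^sup>2) \<longlonglongrightarrow> 0"
      using lim
    proof eventually_elim
      case (elim u)
      have "(\<lambda>n. (clamp_real B (c u) - clamp_real B (g n u))\<^sup>2)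
        \<longlonglongrightarrow> (clamp_real B (c u) - clamp_real B (c u))\<^sup>2"
        by (intro tendsto_intros elim)
      then show ?case by simp
    qed
    show "AE u in M. norm ((clamp_real B (c u) - clamp_real B (g n u))\<^sup>2) \<le> (2 * B)\<^sup>2" for n
    proof (rule AE_I2)
      fix u
      have "\<bar>clamp_real B (c u) - clamp_real B (g n u)\<bar> \<le> \<bar>2 * B\<bar>"
        using \<open>B \<ge> 0\<close> by (auto simp: min_def max_def abs_if)
      then show "norm ((clamp_real B (c u) - clamp_real B (g n u))\<^sup>2) \<le> (2 * B)\<^sup>2"
        unfolding abs_le_square_iff by simp
    qed
  qed simp_all
  then show ?thesis by simp
qed

text \<open>Three approximations in turn: truncate \<open>c\<close>, replace it inside the
  truncation by a continuous function, and approximate the resulting continuous function uniformly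
  on the cube by a polynomial.\<close>

lemma legendre_span_dense:
  fixes c :: "real ^ 'd::finite \<Rightarrow> real"
  assumes c: "c \<in> borel_measurable cube_measure" "integrable cube_measure (\<lambda>u. (c u)\<^sup>2)"
    and "e > 0"
  obtains f where "f \<in> legendre_span" "(\<integral>u. (c u - f u)\<^sup>2 \<partial>cube_measure) < e"
proof -
  note c(1)[measurable]
  \<comment> \<open>One factor 3 is for the three approximations, the other for
    \<open>(a + b + d)^2 \<le> 3 * (a^2 + b^2 + d^2)\<close>.\<close>
  have "e / 9 > 0" using \<open>e > 0\<close> by simp
  obtain B :: nat where B: "(\<integral>u. (c u - clamp_real B (c u))\<^sup>2 \<partial>cube_measure) < e / 9"
    using order_tendstoD(2)[OF clamp_real_L2_tendsto[OF c] \<open>e / 9 > 0\<close>]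
    by (auto simp: eventually_sequentially)
  obtain g where g_cont: "\<And>n::nat. continuous_on UNIV (g n)"
    and lim: "AE u in cube_measure. (\<lambda>n. g n u) \<longlonglongrightarrow> c u"
    using cube_measurable_ae_limit_continuous[OF c(1)] by blast
  have g_meas[measurable]: "g n \<in> borel_measurable cube_measure" for n
    by (intro measurable_cube_measureI borel_measurable_continuous_onI g_cont)
  obtain n where n: "(\<integral>u. (clamp_real B (c u) - clamp_real B (g n u))\<^sup>2 \<partial>cube_measure) < e / 9"
    using order_tendstoD(2)[OF clamp_real_ae_L2_tendsto[OF prob_space_cube_measure c(1) g_meas lim, of B] \<open>e / 9 > 0\<close>]
    by (auto simp: eventually_sequentially)
  have cont: "continuous_on S (\<lambda>u. clamp_real B (g n u))" for S
    by (intro continuous_intros continuous_on_subset[OF g_cont]) auto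
  obtain p where p: "real_polynomial_function p"
    and p_close: "\<And>u. u \<in> cbox 0 1 \<Longrightarrow> \<bar>clamp_real B (g n u) - p u\<bar> < sqrt (e / 9)"
    using Stone_Weierstrass_real_polynomial_function[OF compact_cbox cont, of "sqrt (e / 9)" 0 1] \<open>e > 0\<close>
    by auto
  have p_span: "p \<in> legendre_span" by (rule polynomial_in_legendre_span[OF p])
  have p_cont: "continuous_on S p" for S by (rule continuous_on_legendre_span[OF p_span])
  have p_meas[measurable]: "p \<in> borel_measurable cube_measure"
    by (intro measurable_cube_measureI borel_measurable_continuous_onI p_cont)
  have clamp_bound: "(clamp_real B y)\<^sup>2 \<le> (real B)\<^sup>2" for y
    by (intro abs_le_square_iff[THEN iffD1]) (auto simp: min_def max_def abs_if)
  have clamp_int: "integrable cube_measure (\<lambda>u. (clamp_real B (h u))\<^sup>2)"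
    if [measurable]: "h \<in> borel_measurable cube_measure" for h
    by (rule cube.integrable_const_bound[of _ "(real B)\<^sup>2"]) (use clamp_bound in auto)
  have int1: "integrable cube_measure (\<lambda>u. (c u - clamp_real B (c u))\<^sup>2)"
    by (rule integrable_diff_square) (use c clamp_int[OF c(1)] in auto)
  have int2: "integrable cube_measure (\<lambda>u. (clamp_real B (c u) - clamp_real B (g n u))\<^sup>2)"
    by (rule integrable_diff_square) (use clamp_int[OF c(1)] clamp_int[OF g_meas] in auto)
  have int3: "integrable cube_measure (\<lambda>u. (clamp_real B (g n u) - p u)\<^sup>2)"
    by (intro integrable_cube_continuous continuous_intros cont p_cont)
  have int4: "integrable cube_measure (\<lambda>u. (c u - p u)\<^sup>2)"
    by (rule integrable_diff_square[OF c(1) p_meas c(2)])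
      (intro integrable_cube_continuous continuous_intros p_cont)
  have p3: "(\<integral>u. (clamp_real B (g n u) - p u)\<^sup>2 \<partial>cube_measure) \<le> e / 9"
  proof -
    have "(clamp_real B (g n u) - p u)\<^sup>2 \<le> e / 9" if "u \<in> cbox 0 1" for u
    proof -
      have "\<bar>clamp_real B (g n u) - p u\<bar> \<le> \<bar>sqrt (e / 9)\<bar>" using p_close[OF that] by linarith
      then show ?thesis using \<open>e > 0\<close> unfolding abs_le_square_iff by simp
    qed
    then have "(\<integral>u. (clamp_real B (g n u) - p u)\<^sup>2 \<partial>cube_measure) \<le> (\<integral>u. e / 9 \<partial>(cube_measure :: (real ^ 'd) measure))"
      by (intro integral_mono int3) auto
    then show ?thesis using cube.prob_space[where 'd = 'd] by (simp del: space_cube_measure)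
  qed
  have "(\<integral>u. (c u - p u)\<^sup>2 \<partial>cube_measure) \<le>
     (\<integral>u. 3 * ((c u - clamp_real B (c u))\<^sup>2 + (clamp_real B (c u) - clamp_real B (g n u))\<^sup>2
        + (clamp_real B (g n u) - p u)\<^sup>2) \<partial>cube_measure)"
  proof (intro integral_mono int4)
    have "(a + b + d)\<^sup>2 \<le> 3 * (a\<^sup>2 + b\<^sup>2 + d\<^sup>2)" for a b d :: real
      using sum_squares_bound[of a b] sum_squares_bound[of a d] sum_squares_bound[of b d]
      by (simp add: power2_eq_square algebra_simps)
    from this[of "c u - clamp_real B (c u)" "clamp_real B (c u) - clamp_real B (g n u)" "clamp_real B (g n u) - p u" for u]
    show "(c u - p u)\<^sup>2 \<le> 3 * ((c u - clamp_real B (c u))\<^sup>2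
      + (clamp_real B (c u) - clamp_real B (g n u))\<^sup>2 + (clamp_real B (g n u) - p u)\<^sup>2)" for u
      by simp
  qed (use int1 int2 int3 in simp)
  also have "\<dots> < e"
    using B n p3 int1 int2 int3 by simp
  finally show thesis using that p_span by blast
qed

text \<open>A single span element \<open>f\<close> close to \<open>c\<close> controls the projection
  for every index vector beyond the threshold of \<open>f\<close>, so \<open>N\<close> may approach
  infinity without being monotone.\<close>

lemma legendre_proj_L2_tendsto:
  fixes c :: "real ^ 'd::finite \<Rightarrow> real"
  assumes c: "c \<in> borel_measurable cube_measure" "integrable cube_measure (\<lambda>u. (c u)\<^sup>2)"
    and N: "\<And>j. filterlim (\<lambda>n. N n j) at_top F"
  shows "((\<lambda>n. \<integral>u. (c u - legendre_proj (N n) c u)\<^sup>2 \<partial>cube_measure) \<longlongrightarrow> 0) F"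
proof (rule tendstoI)
  fix e :: real assume "e > 0"
  obtain f where f: "f \<in> legendre_span" "(\<integral>u. (c u - f u)\<^sup>2 \<partial>cube_measure) < e"
    using legendre_span_dense[OF c \<open>e > 0\<close>] .
  obtain K where K: "\<And>N. \<forall>j. K \<le> N j \<Longrightarrow> legendre_proj N f = f"
    using legendre_proj_span[OF f(1)] by blast
  have "eventually (\<lambda>n. \<forall>j. K \<le> N n j) F"
    using N by (simp add: filterlim_at_top eventually_all_finite)
  then show "eventually (\<lambda>n. dist (\<integral>u. (c u - legendre_proj (N n) c u)\<^sup>2 \<partial>cube_measure) 0 < e) F"
  proof eventually_elim
    case (elim n)
    have "(\<integral>u. (c u - legendre_proj (N n) c u)\<^sup>2 \<partial>cube_measure) < e"
      using legendre_proj_best_approx[OF c f(1) K[OF elim]] f(2) by simp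
    then show ?case by simp
  qed
qed

subsection \<open>Moment bounds for the estimated coefficients\<close>

lemma tensor_legendre_0 [simp]: "tensor_legendre (\<lambda>_. 0) u = 1"
  by (simp add: tensor_legendre_def)

lemma tensor_legendre_eq:
  "tensor_legendre m u = (\<Prod>j\<in>UNIV. sqrt (real (2 * m j + 1))) * (\<Prod>j\<in>UNIV. legendre (m j) (2 * u $ j - 1))"
  by (simp add: tensor_legendre_def shifted_legendre_def prod.distrib)

lemma prod_sqrt_le:
  fixes m :: "'d::finite \<Rightarrow> nat"
  assumes "\<And>j. m j \<le> K"
  shows "(\<Prod>j\<in>UNIV. sqrt (real (2 * m j + 1))) \<le> sqrt (real (2 * K + 1)) ^ CARD('d)"
proof -
  have "(\<Prod>j\<in>UNIV. sqrt (real (2 * m j + 1))) \<le> (\<Prod>j\<in>(UNIV :: 'd set). sqrt (real (2 * K + 1)))"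
    using assms by (intro prod_mono) simp
  then show ?thesis by simp
qed

lemma abs_tensor_legendre_le:
  fixes u :: "real ^ 'd::finite"
  assumes u: "u \<in> cbox 0 1" and m: "\<And>j. m j \<le> K"
  shows "\<bar>tensor_legendre m u\<bar> \<le> sqrt (real (2 * K + 1)) ^ CARD('d)"
proof -
  have "(\<Prod>j\<in>UNIV. \<bar>legendre (m j) (2 * u $ j - 1)\<bar>) \<le> 1"
  proof (rule prod_le_1)
    fix j
    have "\<bar>2 * u $ j - 1\<bar> \<le> 1" using u by (auto simp: mem_box_cart abs_le_iff)
    then show "0 \<le> \<bar>legendre (m j) (2 * u $ j - 1)\<bar> \<and> \<bar>legendre (m j) (2 * u $ j - 1)\<bar> \<le> 1"
      using abs_legendre_le_1 by simp
  qed
  then have "\<bar>tensor_legendre m u\<bar> \<le> (\<Prod>j\<in>UNIV. sqrt (real (2 * m j + 1))) * 1"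
    unfolding tensor_legendre_eq abs_mult abs_prod
    by (intro mult_mono prod_mono) (auto intro!: prod_nonneg)
  then show ?thesis using prod_sqrt_le[of m K] m by fastforce
qed

text \<open>With the normalizing square roots pulled out, all factors lie in \<open>[-1, 1]\<close>,
  so the difference of two products is at most the sum of the differences of the factors. The 2 in
  the argument \<open>2 x - 1\<close> cancels the 2 in the derivative bound.\<close>

lemma tensor_legendre_lipschitz:
  fixes u v :: "real ^ 'd::finite"
  assumes u: "u \<in> cbox 0 1" and v: "v \<in> cbox 0 1" and m: "\<And>j. m j \<le> K"
  shows "\<bar>tensor_legendre m u - tensor_legendre m v\<bar>
    \<le> sqrt (real (2 * K + 1)) ^ CARD('d) * (real K * real (Suc K)) * (\<Sum>j\<in>UNIV. \<bar>u $ j - v $ j\<bar>)"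
proof -
  have box: "\<bar>2 * w $ j - 1\<bar> \<le> 1" if "w \<in> cbox 0 1" for w :: "real ^ 'd" and j
    using that by (auto simp: mem_box_cart abs_le_iff)
  have "\<bar>(\<Prod>j\<in>UNIV. legendre (m j) (2 * u $ j - 1)) - (\<Prod>j\<in>UNIV. legendre (m j) (2 * v $ j - 1))\<bar>
      \<le> (\<Sum>j\<in>UNIV. \<bar>legendre (m j) (2 * u $ j - 1) - legendre (m j) (2 * v $ j - 1)\<bar>)"
    using norm_prod_diff[of UNIV "\<lambda>j. legendre (m j) (2 * u $ j - 1)" "\<lambda>j. legendre (m j) (2 * v $ j - 1)"]
      abs_legendre_le_1 box[OF u] box[OF v] by simp
  also have "\<dots> \<le> (\<Sum>j\<in>UNIV. real K * real (Suc K) * \<bar>u $ j - v $ j\<bar>)"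
  proof (rule sum_mono)
    fix j
    have "\<bar>legendre (m j) (2 * u $ j - 1) - legendre (m j) (2 * v $ j - 1)\<bar>
        \<le> real (m j) * real (Suc (m j)) / 2 * \<bar>(2 * u $ j - 1) - (2 * v $ j - 1)\<bar>"
      by (rule legendre_lipschitz[OF box[OF u] box[OF v]])
    also have "(2 * u $ j - 1) - (2 * v $ j - 1) = 2 * (u $ j - v $ j)" by simp
    also have "real (m j) * real (Suc (m j)) / 2 * \<bar>2 * (u $ j - v $ j)\<bar>
        = real (m j) * real (Suc (m j)) * \<bar>u $ j - v $ j\<bar>"
      unfolding abs_mult by simp
    also have "\<dots> \<le> real K * real (Suc K) * \<bar>u $ j - v $ j\<bar>"
      using m[of j] by (intro mult_right_mono mult_mono) auto
    finally show "\<bar>legendre (m j) (2 * u $ j - 1) - legendre (m j) (2 * v $ j - 1)\<bar>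
        \<le> real K * real (Suc K) * \<bar>u $ j - v $ j\<bar>" .
  qed
  finally have "\<bar>tensor_legendre m u - tensor_legendre m v\<bar> \<le> (\<Prod>j\<in>UNIV. sqrt (real (2 * m j + 1)))
      * (\<Sum>j\<in>UNIV. real K * real (Suc K) * \<bar>u $ j - v $ j\<bar>)"
    unfolding tensor_legendre_eq right_diff_distrib[symmetric] abs_mult
    by (intro mult_mono) (auto simp: abs_prod intro!: prod_nonneg)
  also have "\<dots> \<le> sqrt (real (2 * K + 1)) ^ CARD('d)
      * (\<Sum>j\<in>UNIV. real K * real (Suc K) * \<bar>u $ j - v $ j\<bar>)"
    using prod_sqrt_le[of m K] m by (intro mult_right_mono) (auto intro!: sum_nonneg)
  finally show ?thesis by (simp only: sum_distrib_left mult.assoc)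
qed

section \<open>Second moments, uniform margins and centring by independence\<close>

text \<open>Expanding the square, row \<open>k\<close> retains at most \<open>s\<close> nonzero
  terms, each at most \<open>B^2\<close>. The exceptional set \<open>S k\<close> may depend on
  \<open>k\<close> and contain a common index; the empirical distribution function requires
  this.\<close>

lemma (in prob_space) expectation_sum_square_le:
  fixes W :: "'i \<Rightarrow> 'a \<Rightarrow> real"
  assumes "finite A"
    and [measurable]: "\<And>k. k \<in> A \<Longrightarrow> random_variable borel (W k)"
    and bound: "\<And>k \<omega>. k \<in> A \<Longrightarrow> \<omega> \<in> space M \<Longrightarrow> \<bar>W k \<omega>\<bar> \<le> B"
    and uncorr: "\<And>k l. k \<in> A \<Longrightarrow> l \<in> A \<Longrightarrow> l \<notin> S k \<Longrightarrow> expectation (\<lambda>\<omega>. W k \<omega> * W l \<omega>) = 0"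
    and S: "\<And>k. k \<in> A \<Longrightarrow> finite (S k)" "\<And>k. k \<in> A \<Longrightarrow> card (S k) \<le> s"
  shows "expectation (\<lambda>\<omega>. (\<Sum>k\<in>A. W k \<omega>)\<^sup>2) \<le> real (card A) * real s * B\<^sup>2"
proof -
  have prod_bound: "\<bar>W k \<omega> * W l \<omega>\<bar> \<le> B\<^sup>2" if "k \<in> A" "l \<in> A" "\<omega> \<in> space M" for k l \<omega>
    unfolding abs_mult power2_eq_square
    using bound[OF that(1,3)] bound[OF that(2,3)] by (intro mult_mono) linarith+
  have int: "integrable M (\<lambda>\<omega>. W k \<omega> * W l \<omega>)" if "k \<in> A" "l \<in> A" for k l
    by (rule integrable_const_bound[of _ "B\<^sup>2"]) (use prod_bound that in auto)
  have le: "expectation (\<lambda>\<omega>. W k \<omega> * W l \<omega>) \<le> B\<^sup>2" if "k \<in> A" "l \<in> A" for k l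
  proof -
    have "expectation (\<lambda>\<omega>. W k \<omega> * W l \<omega>) \<le> expectation (\<lambda>_. B\<^sup>2)"
      by (intro integral_mono int that) (use prod_bound[OF that] in \<open>auto simp: abs_le_iff\<close>)
    then show ?thesis by (simp add: prob_space)
  qed
  have "expectation (\<lambda>\<omega>. (\<Sum>k\<in>A. W k \<omega>)\<^sup>2) = expectation (\<lambda>\<omega>. \<Sum>k\<in>A. \<Sum>l\<in>A. W k \<omega> * W l \<omega>)"
    by (simp add: power2_eq_square sum_product)
  also have "\<dots> = (\<Sum>k\<in>A. expectation (\<lambda>\<omega>. \<Sum>l\<in>A. W k \<omega> * W l \<omega>))"
    by (intro Bochner_Integration.integral_sum Bochner_Integration.integrable_sum int)
  also have "\<dots> = (\<Sum>k\<in>A. \<Sum>l\<in>A. expectation (\<lambda>\<omega>. W k \<omega> * W l \<omega>))"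
    by (intro sum.cong refl Bochner_Integration.integral_sum int)
  also have "\<dots> \<le> (\<Sum>k\<in>A. real s * B\<^sup>2)"
  proof (rule sum_mono)
    fix k assume k: "k \<in> A"
    have "(\<Sum>l\<in>A. expectation (\<lambda>\<omega>. W k \<omega> * W l \<omega>)) = (\<Sum>l\<in>A \<inter> S k. expectation (\<lambda>\<omega>. W k \<omega> * W l \<omega>))"
      using \<open>finite A\<close> uncorr[OF k] by (intro sum.mono_neutral_right) auto
    also have "\<dots> \<le> (\<Sum>l\<in>A \<inter> S k. B\<^sup>2)"
      using le k by (intro sum_mono) auto
    also have "\<dots> = real (card (A \<inter> S k)) * B\<^sup>2" by simp
    also have "\<dots> \<le> real s * B\<^sup>2"
      using card_mono[OF S(1)[OF k], of "A \<inter> S k"] S(2)[OF k]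
      by (intro mult_right_mono) auto
    finally show "(\<Sum>l\<in>A. expectation (\<lambda>\<omega>. W k \<omega> * W l \<omega>)) \<le> real s * B\<^sup>2" .
  qed
  finally show ?thesis by (simp add: mult.assoc)
qed

text \<open>The probability integral transform. A continuous distribution function need not be
  injective, so instead of inverting it the proof takes preimages of levels from the intermediate
  value theorem and sandwiches the event \<open>F (Y \<omega>) \<le> t\<close> between events
  \<open>Y \<omega> \<le> x\<close>.\<close>

lemma (in prob_space) distributed_cdf_uniform:
  assumes [measurable]: "random_variable borel Y"
    and cont: "continuous_on UNIV (cdf (distr M borel Y))"
  shows "distributed M lborel (\<lambda>\<omega>. cdf (distr M borel Y) (Y \<omega>)) (\<lambda>x. indicator {0..1} x / measure lborel {0..1 :: real})"
proof -
  define F where "F = cdf (distr M borel Y)"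
  interpret D: real_distribution "distr M borel Y" by simp
  have cont: "continuous_on UNIV F" using cont by (simp add: F_def)
  have F: "F x = prob {\<omega> \<in> space M. Y \<omega> \<le> x}" for x
    unfolding F_def cdf_def by (subst measure_distr) (auto intro!: arg_cong[where f = prob])
  have F_mono: "x \<le> y \<Longrightarrow> F x \<le> F y" for x y by (simp add: F_def D.cdf_nondecreasing)
  have F_le_1: "F x \<le> 1" for x by (simp add: F)
  have [measurable]: "F \<in> borel_measurable borel" by (rule borel_measurable_continuous_onI[OF cont])
  have ivt: "\<exists>x. F x = t" if t: "0 < t" "t < 1" for t
  proof -
    obtain a where a: "F a < t"
      using order_tendstoD(2)[OF D.cdf_lim_at_bot t(1)] unfolding F_def eventually_at_bot_linorder by auto
    obtain b where b: "t < F b"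
      using order_tendstoD(1)[OF D.cdf_lim_at_top_prob t(2)] unfolding F_def eventually_at_top_linorder by auto
    have "a \<le> b" using a b F_mono[of b a] by linarith
    then show ?thesis
      using IVT'[of F a t b] a b continuous_on_subset[OF cont] by force
  qed
  \<comment> \<open>The level \<open>s\<close> lies strictly above \<open>t\<close>: where
    \<open>F\<close> is flat at level \<open>t\<close>, \<open>F (Y \<omega>) \<le> t\<close> does
    not force \<open>Y \<omega> \<le> x\<close> for a given \<open>x\<close> with
    \<open>F x = t\<close>.\<close>
  have upper: "prob {\<omega> \<in> space M. F (Y \<omega>) \<le> t} \<le> t" if t: "0 \<le> t" "t < 1" for t
  proof (rule dense_ge_bounded[OF t(2)])
    fix s assume s: "t < s" "s < 1"
    obtain x where x: "F x = s" using ivt[of s] s t by auto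
    have "{\<omega> \<in> space M. F (Y \<omega>) \<le> t} \<subseteq> {\<omega> \<in> space M. Y \<omega> \<le> x}"
      using x s F_mono by (smt (verit) Collect_mono)
    then show "prob {\<omega> \<in> space M. F (Y \<omega>) \<le> t} \<le> s"
      using finite_measure_mono[of _ "{\<omega> \<in> space M. Y \<omega> \<le> x}"] x by (simp add: F)
  qed
  have lower: "t \<le> prob {\<omega> \<in> space M. F (Y \<omega>) \<le> t}" if t: "0 < t" "t < 1" for t
  proof -
    obtain x where x: "F x = t" using ivt[OF t] by auto
    have "{\<omega> \<in> space M. Y \<omega> \<le> x} \<subseteq> {\<omega> \<in> space M. F (Y \<omega>) \<le> t}"
      using x F_mono by auto
    then have "prob {\<omega> \<in> space M. Y \<omega> \<le> x} \<le> prob {\<omega> \<in> space M. F (Y \<omega>) \<le> t}"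
      by (intro finite_measure_mono) auto
    then show ?thesis using x by (simp add: F)
  qed
  have "prob {\<omega> \<in> space M. F (Y \<omega>) \<le> t} = t" if "0 \<le> t" "t \<le> 1" for t
  proof (cases "t = 1")
    case True
    then show ?thesis using F_le_1 by (simp add: prob_space)
  next
    case False
    then show ?thesis
      using upper[of t] lower[of t] that measure_nonneg[of M "{\<omega> \<in> space M. F (Y \<omega>) \<le> t}"]
      by (cases "t = 0") (auto intro: antisym)
  qed
  then show ?thesis
    unfolding F_def[symmetric] by (subst uniform_distributed_iff) simp
qed

text \<open>Fubini for the joint law stands in for conditioning on \<open>Z\<close>, and the uniform
  bound supplies integrability. Centring is required only with \<open>z\<close> frozen, so
  \<open>z\<close> may include a random evaluation point.\<close>

lemma (in prob_space) expectation_eq_0_if_indep: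
  fixes h :: "'b \<Rightarrow> 'b \<Rightarrow> real"
  assumes indep: "indep_var S Z T Y"
    and [measurable]: "case_prod h \<in> borel_measurable (S \<Otimes>\<^sub>M T)"
    and bound: "\<And>z y. \<bar>h z y\<bar> \<le> B"
    and zero: "\<And>z. z \<in> space S \<Longrightarrow> expectation (\<lambda>\<omega>. h z (Y \<omega>)) = 0"
  shows "expectation (\<lambda>\<omega>. h (Z \<omega>) (Y \<omega>)) = 0"
proof -
  have [measurable]: "random_variable S Z" "random_variable T Y"
    and joint: "distr M S Z \<Otimes>\<^sub>M distr M T Y = distr M (S \<Otimes>\<^sub>M T) (\<lambda>x. (Z x, Y x))"
    using indep unfolding indep_var_distribution_eq by auto
  interpret Z: prob_space "distr M S Z" by (rule prob_space_distr) simp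
  interpret Y: prob_space "distr M T Y" by (rule prob_space_distr) simp
  interpret P: pair_prob_space "distr M S Z" "distr M T Y" ..
  have "expectation (\<lambda>\<omega>. h (Z \<omega>) (Y \<omega>)) = (\<integral>p. case_prod h p \<partial>distr M (S \<Otimes>\<^sub>M T) (\<lambda>x. (Z x, Y x)))"
    by (subst integral_distr) simp_all
  also have "\<dots> = (\<integral>z. \<integral>y. h z y \<partial>distr M T Y \<partial>distr M S Z)"
    unfolding joint[symmetric]
    by (rule P.integral_fst[symmetric], rule P.integrable_const_bound[of _ B])
      (use bound in auto)
  also have "\<dots> = (\<integral>z. 0 \<partial>distr M S Z)"
  proof (rule Bochner_Integration.integral_cong)
    fix z assume "z \<in> space (distr M S Z)"
    then have z: "z \<in> space S" by simp
    have [measurable]: "h z \<in> borel_measurable T"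
      using measurable_compose[OF measurable_Pair1'[OF z], of "case_prod h"] by simp
    show "(\<integral>y. h z y \<partial>distr M T Y) = 0"
      using zero[OF z] by (subst integral_distr) simp_all
  qed simp
  finally show ?thesis by simp
qed

section \<open>The sample, its copula transform and its scaled ranks\<close>

locale copula_sample = prob_space M
  for M :: "'a measure" +
  fixes X :: "nat \<Rightarrow> 'a \<Rightarrow> real ^ 'd::finite"
  assumes indep: "indep_vars (\<lambda>_. borel) X UNIV"
    and ident: "\<And>i. distr M borel (X i) = distr M borel (X 0)"
    and cont: "\<And>j. continuous_on UNIV (marginal_cdf M (X 0) j)"
begin

definition F :: "'d \<Rightarrow> real \<Rightarrow> real" where
  "F j = marginal_cdf M (X 0) j"

definition U :: "nat \<Rightarrow> 'a \<Rightarrow> real ^ 'd" where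
  "U i \<omega> = (\<chi> j. F j (X i \<omega> $ j))"

text \<open>For \<open>i < n\<close> these are the componentwise ranks divided by \<open>n\<close>,
  ties receiving the maximal rank. Unlike \<open>U i\<close>, they are computable from the data, but
  each one depends on the whole sample.\<close>

definition pseudo_obs :: "nat \<Rightarrow> nat \<Rightarrow> 'a \<Rightarrow> real ^ 'd" where
  "pseudo_obs n i \<omega> = (\<chi> j. empirical_cdf n (\<lambda>i. X i \<omega>) j (X i \<omega> $ j))"

definition copula_coeff :: "('d \<Rightarrow> nat) \<Rightarrow> real" where
  "copula_coeff m = expectation (\<lambda>\<omega>. tensor_legendre m (U 0 \<omega>))"

lemma X_measurable [measurable]: "random_variable borel (X i)"
  using indep by (simp add: indep_vars_def)

lemma vec_nth_measurable [measurable]: "(\<lambda>x :: real ^ 'd. x $ j) \<in> borel_measurable borel"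
  by (intro borel_measurable_continuous_onI continuous_intros)

lemma F_measurable [measurable]: "F j \<in> borel_measurable borel"
  unfolding F_def by (rule borel_measurable_continuous_onI[OF cont])

lemma expectation_X:
  fixes f :: "real ^ 'd \<Rightarrow> real"
  assumes [measurable]: "f \<in> borel_measurable borel"
  shows "expectation (\<lambda>\<omega>. f (X i \<omega>)) = expectation (\<lambda>\<omega>. f (X 0 \<omega>))"
proof -
  have "expectation (\<lambda>\<omega>. f (X i \<omega>)) = integral\<^sup>L (distr M borel (X i)) f"
    by (subst integral_distr) simp_all
  also have "\<dots> = expectation (\<lambda>\<omega>. f (X 0 \<omega>))"
    unfolding ident[of i] by (subst integral_distr) simp_all
  finally show ?thesis .
qed

lemma F_eq: "F j t = expectation (\<lambda>\<omega>. of_bool (X i \<omega> $ j \<le> t))"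
proof -
  have "F j t = prob {\<omega> \<in> space M. X 0 \<omega> $ j \<le> t}"
    unfolding F_def marginal_cdf_def cdf_def
    by (subst measure_distr) (auto intro!: arg_cong[where f = prob])
  also have "\<dots> = expectation (indicator {\<omega> \<in> space M. X 0 \<omega> $ j \<le> t})"
    by simp
  also have "\<dots> = expectation (\<lambda>\<omega>. of_bool (X 0 \<omega> $ j \<le> t))"
    by (intro Bochner_Integration.integral_cong) (auto simp: indicator_def)
  also have "\<dots> = expectation (\<lambda>\<omega>. of_bool (X i \<omega> $ j \<le> t))"
    unfolding of_bool_def by (rule expectation_X[symmetric]) measurable
  finally show ?thesis .
qed

lemma F_nonneg: "0 \<le> F j t" and F_le_1: "F j t \<le> 1"
proof -
  interpret D: real_distribution "distr M borel (\<lambda>\<omega>. X 0 \<omega> $ j)" by simp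
  show "0 \<le> F j t" "F j t \<le> 1"
    by (simp_all add: F_def marginal_cdf_def D.cdf_nonneg D.cdf_bounded_prob)
qed

lemma U_in_cube: "U i \<omega> \<in> cbox 0 1"
  by (simp add: U_def mem_box_cart F_nonneg F_le_1)

lemma pseudo_obs_in_cube: "pseudo_obs n i \<omega> \<in> cbox 0 1"
proof -
  have "(\<Sum>k<n. of_bool (X k \<omega> $ j \<le> t)) \<le> real n" for j t
    using sum_bounded_above[of "{..<n}" "\<lambda>k. of_bool (X k \<omega> $ j \<le> t)" "1 :: real"] by simp
  then show ?thesis
    by (auto simp: pseudo_obs_def mem_box_cart empirical_cdf_def divide_le_eq_1 sum_nonneg)
qed

lemma tensor_legendre_U_measurable [measurable]:
  "random_variable borel (\<lambda>\<omega>. tensor_legendre m (U i \<omega>))"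
  unfolding tensor_legendre_def U_def by simp

lemma pseudo_obs_component_measurable [measurable]:
  "random_variable borel (\<lambda>\<omega>. pseudo_obs n i \<omega> $ j)"
  unfolding pseudo_obs_def empirical_cdf_def of_bool_def by simp

lemma U_component_measurable [measurable]: "random_variable borel (\<lambda>\<omega>. U i \<omega> $ j)"
  unfolding U_def by simp

lemma tensor_legendre_pseudo_obs_measurable [measurable]:
  "random_variable borel (\<lambda>\<omega>. tensor_legendre m (pseudo_obs n i \<omega>))"
  unfolding tensor_legendre_def by measurable

lemma estimator_measurable [measurable]:
  "random_variable borel (\<lambda>\<omega>. copula_coeff_estimator n (\<lambda>i. X i \<omega>) m)"
  unfolding copula_coeff_estimator_def pseudo_obs_def[symmetric] by measurable

text \<open>\<open>W l\<close> is centred given \<open>X i\<close> only for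
  \<open>l \<noteq> i\<close>, whereas \<open>W i\<close> is
  \<open>1 - F j (X i \<omega> $ j)\<close>. Hence row \<open>k\<close> of the squared sum exempts
  both \<open>k\<close> and \<open>i\<close>, which accounts for the 2 in the bound.\<close>

lemma pseudo_obs_error:
  assumes "i < n"
  shows "expectation (\<lambda>\<omega>. (pseudo_obs n i \<omega> $ j - U i \<omega> $ j)\<^sup>2) \<le> 2 / real n"
proof -
  define W where "W k \<omega> = of_bool (X k \<omega> $ j \<le> X i \<omega> $ j) - F j (X i \<omega> $ j)" for k \<omega>
  have n: "n > 0" using assms by simp
  have bound: "\<bar>of_bool b - F j t\<bar> \<le> 1" for b t
    using F_nonneg[of j t] F_le_1[of j t] by (cases b) auto
  \<comment> \<open>\<open>X l\<close> is independent of \<open>(X i, X k)\<close>, so integrating it out first centres \<open>W l\<close>.\<close>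
  have uncorr: "expectation (\<lambda>\<omega>. W k \<omega> * W l \<omega>) = 0" if "l \<notin> {i, k}" for k l
  proof -
    have ind: "indep_var (PiM {i, k} (\<lambda>_. borel)) (\<lambda>\<omega>. restrict (\<lambda>i. X i \<omega>) {i, k})
        (PiM {l} (\<lambda>_. borel)) (\<lambda>\<omega>. restrict (\<lambda>i. X i \<omega>) {l})"
      using that by (intro indep_var_restrict[OF indep]) auto
    define h :: "(nat \<Rightarrow> real ^ 'd) \<Rightarrow> (nat \<Rightarrow> real ^ 'd) \<Rightarrow> real" where
      "h z y = (of_bool (z k $ j \<le> z i $ j) - F j (z i $ j)) * (of_bool (y l $ j \<le> z i $ j) - F j (z i $ j))" for z y
    have "expectation (\<lambda>\<omega>. h (restrict (\<lambda>i. X i \<omega>) {i, k}) (restrict (\<lambda>i. X i \<omega>) {l})) = 0"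
    proof (rule expectation_eq_0_if_indep[OF ind, where B = 1])
      show "case_prod h \<in> borel_measurable (PiM {i, k} (\<lambda>_. borel) \<Otimes>\<^sub>M PiM {l} (\<lambda>_. borel))"
        unfolding h_def of_bool_def by measurable
      show "\<bar>h z y\<bar> \<le> 1" for z y
        unfolding h_def abs_mult by (intro mult_le_one bound) simp
      fix z :: "nat \<Rightarrow> real ^ 'd"
      have "integrable M (\<lambda>\<omega>. of_bool (X l \<omega> $ j \<le> z i $ j) :: real)"
        by (rule integrable_const_bound[of _ 1]) (auto simp: of_bool_def)
      then show "expectation (\<lambda>\<omega>. h z (restrict (\<lambda>i. X i \<omega>) {l})) = 0"
        unfolding h_def by (simp add: F_eq[of j "z i $ j" l] prob_space)
    qed
    then show ?thesis by (simp add: h_def W_def)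
  qed
  have "expectation (\<lambda>\<omega>. (\<Sum>k<n. W k \<omega>)\<^sup>2) \<le> real (card {..<n}) * real 2 * 1\<^sup>2"
  proof (rule expectation_sum_square_le[where S = "\<lambda>k. {i, k}"])
    show "random_variable borel (W k)" for k
      unfolding W_def of_bool_def by measurable
    show "\<bar>W k \<omega>\<bar> \<le> 1" for k \<omega> unfolding W_def by (rule bound)
    show "card {i, k} \<le> 2" for k by (simp add: card_insert_if)
  qed (use uncorr in auto)
  moreover have "(pseudo_obs n i \<omega> $ j - U i \<omega> $ j)\<^sup>2 = (\<Sum>k<n. W k \<omega>)\<^sup>2 / (real n)\<^sup>2" for \<omega>
    using n by (simp add: pseudo_obs_def U_def empirical_cdf_def W_def sum_subtractf diff_divide_distrib
        flip: power_divide)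
  ultimately have "expectation (\<lambda>\<omega>. (pseudo_obs n i \<omega> $ j - U i \<omega> $ j)\<^sup>2) \<le> real n * 2 / (real n)\<^sup>2"
    using n by (simp add: divide_right_mono)
  then show ?thesis
    using n by (simp add: power2_eq_square)
qed

lemma integrable_pseudo_obs_error:
  "integrable M (\<lambda>\<omega>. (pseudo_obs n i \<omega> $ j - U i \<omega> $ j)\<^sup>2)"
proof (rule integrable_const_bound[of _ 1])
  have "\<bar>pseudo_obs n i \<omega> $ j - U i \<omega> $ j\<bar> \<le> 1" for \<omega>
    using pseudo_obs_in_cube[of n i \<omega>] U_in_cube[of i \<omega>]
    by (auto simp: mem_box_cart abs_le_iff) (smt (verit))+
  then show "AE \<omega> in M. norm ((pseudo_obs n i \<omega> $ j - U i \<omega> $ j)\<^sup>2) \<le> 1"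
    by (simp add: abs_square_le_1)
qed measurable

lemma abs_copula_coeff_le:
  assumes "\<And>j. m j \<le> K"
  shows "\<bar>copula_coeff m\<bar> \<le> sqrt (real (2 * K + 1)) ^ CARD('d)"
proof -
  have "\<bar>copula_coeff m\<bar> \<le> expectation (\<lambda>\<omega>. \<bar>tensor_legendre m (U 0 \<omega>)\<bar>)"
    unfolding copula_coeff_def by (rule integral_abs_bound)
  also have "\<dots> \<le> expectation (\<lambda>_. sqrt (real (2 * K + 1)) ^ CARD('d))"
    using abs_tensor_legendre_le[where m = m and K = K, OF U_in_cube assms]
    by (intro integral_mono integrable_const_bound[of _ "sqrt (real (2 * K + 1)) ^ CARD('d)"]) auto
  finally show ?thesis by (simp add: prob_space)
qed

lemma sampling_error:
  assumes m: "\<And>j. m j \<le> K"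
  shows "expectation (\<lambda>\<omega>. (\<Sum>i<n. tensor_legendre m (U i \<omega>) - copula_coeff m)\<^sup>2)
    \<le> 4 * real (2 * K + 1) ^ CARD('d) * real n"
proof -
  define b where "b = sqrt (real (2 * K + 1)) ^ CARD('d)"
  define w where "w x = tensor_legendre m (\<chi> j. F j (x $ j)) - copula_coeff m" for x :: "real ^ 'd"
  have w_U: "w (X i \<omega>) = tensor_legendre m (U i \<omega>) - copula_coeff m" for i \<omega>
    by (simp add: w_def U_def)
  have [measurable]: "w \<in> borel_measurable borel"
    unfolding w_def tensor_legendre_def by simp
  have bound: "\<bar>w x\<bar> \<le> 2 * b" for x
  proof -
    have "(\<chi> j. F j (x $ j)) \<in> cbox 0 1" by (simp add: mem_box_cart F_nonneg F_le_1)
    from abs_tensor_legendre_le[where m = m and K = K, OF this m] abs_copula_coeff_le[where m = m and K = K, OF m]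
    show ?thesis unfolding w_def b_def[symmetric] by linarith
  qed
  have mean: "expectation (\<lambda>\<omega>. w (X i \<omega>)) = 0" for i
  proof -
    have "integrable M (\<lambda>\<omega>. tensor_legendre m (U 0 \<omega>))"
      using abs_tensor_legendre_le[where m = m and K = K, OF U_in_cube m]
      by (intro integrable_const_bound[of _ b]) (auto simp: b_def)
    then have "expectation (\<lambda>\<omega>. w (X 0 \<omega>)) = 0"
      by (simp add: w_U copula_coeff_def prob_space)
    then show ?thesis by (subst expectation_X) simp_all
  qed
  have uncorr: "expectation (\<lambda>\<omega>. w (X k \<omega>) * w (X l \<omega>)) = 0" if "l \<notin> {k}" for k l
  proof -
    have ind: "indep_var (PiM {k} (\<lambda>_. borel)) (\<lambda>\<omega>. restrict (\<lambda>i. X i \<omega>) {k})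
        (PiM {l} (\<lambda>_. borel)) (\<lambda>\<omega>. restrict (\<lambda>i. X i \<omega>) {l})"
      using that by (intro indep_var_restrict[OF indep]) auto
    define h :: "(nat \<Rightarrow> real ^ 'd) \<Rightarrow> (nat \<Rightarrow> real ^ 'd) \<Rightarrow> real" where
      "h z y = w (z k) * w (y l)" for z y
    have "expectation (\<lambda>\<omega>. h (restrict (\<lambda>i. X i \<omega>) {k}) (restrict (\<lambda>i. X i \<omega>) {l})) = 0"
    proof (rule expectation_eq_0_if_indep[OF ind, where B = "2 * b * (2 * b)"])
      show "case_prod h \<in> borel_measurable (PiM {k} (\<lambda>_. borel) \<Otimes>\<^sub>M PiM {l} (\<lambda>_. borel))"
        unfolding h_def by measurable
      show "\<bar>h z y\<bar> \<le> 2 * b * (2 * b)" for z y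
        unfolding h_def abs_mult by (intro mult_mono bound) (simp_all add: b_def)
      show "expectation (\<lambda>\<omega>. h z (restrict (\<lambda>i. X i \<omega>) {l})) = 0" for z
        unfolding h_def by (simp add: mean)
    qed
    then show ?thesis by (simp add: h_def)
  qed
  \<comment> \<open>Here only the diagonal survives; squaring the bound \<open>2 * b\<close> on the
    centred summands produces the factor 4.\<close>
  have "expectation (\<lambda>\<omega>. (\<Sum>i<n. w (X i \<omega>))\<^sup>2) \<le> real (card {..<n}) * real 1 * (2 * b)\<^sup>2"
    by (rule expectation_sum_square_le[where S = "\<lambda>k. {k}"]) (use uncorr bound in auto)
  moreover have "b\<^sup>2 = real (2 * K + 1) ^ CARD('d)"
    by (simp add: b_def power2_eq_square flip: power_mult_distrib)
  ultimately show ?thesis by (simp add: w_U power_mult_distrib mult_ac)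
qed

lemma copula_coeff_0 [simp]: "copula_coeff (\<lambda>_. 0) = 1"
  by (simp add: copula_coeff_def prob_space)

lemma expectation_U:
  fixes g :: "real \<Rightarrow> real"
  assumes g: "continuous_on UNIV g"
  shows "expectation (\<lambda>\<omega>. g (U 0 \<omega> $ j)) = integral {0..1} g"
proof -
  have [measurable]: "g \<in> borel_measurable borel" by (rule borel_measurable_continuous_onI[OF g])
  have "distributed M lborel (\<lambda>\<omega>. U 0 \<omega> $ j) (\<lambda>x. indicator {0..1} x / measure lborel {0..1 :: real})"
    using distributed_cdf_uniform[of "\<lambda>\<omega>. X 0 \<omega> $ j"] cont[of j]
    by (simp add: U_def F_def marginal_cdf_def)
  then have "expectation (\<lambda>\<omega>. g (U 0 \<omega> $ j)) = (\<integral>x. indicator {0..1} x / measure lborel {0..1 :: real} * g x \<partial>lborel)"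
    by (subst distributed_integral[symmetric, where g = g]) auto
  also have "\<dots> = (\<integral>x. indicator {0..1} x * g x \<partial>lborel)" by simp
  also have "\<dots> = integral UNIV (\<lambda>x. indicator {0..1} x * g x)"
    using borel_integrable_compact[OF compact_Icc continuous_on_subset[OF g subset_UNIV], of 0 1]
    by (intro integral_lborel[symmetric]) simp
  also have "(\<lambda>x. indicator {0..1} x * g x) = (\<lambda>x. if x \<in> {0..1} then g x else 0)"
    by (auto simp: fun_eq_iff)
  finally show ?thesis by (simp only: integral_restrict_UNIV)
qed

text \<open>This justifies the value 0 in the estimator: only one factor differs from 1, its
  argument is uniform, and it is orthogonal to \<open>Q_0 = 1\<close>.\<close>

lemma copula_coeff_single:
  assumes "m \<noteq> (\<lambda>_. 0)" "card {j. m j = 0} = CARD('d) - 1"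
  shows "copula_coeff m = 0"
proof -
  have "card (- {j. m j = 0}) = CARD('d) - (CARD('d) - 1)"
    using assms(2) unfolding Compl_eq_Diff_UNIV by (subst card_Diff_subset) simp_all
  also have "\<dots> = 1" using zero_less_card_finite[where 'a = 'd] by linarith
  finally obtain j where "- {j. m j = 0} = {j}" using card_1_singletonE by blast
  then have j: "m j \<noteq> 0" "\<And>i. i \<noteq> j \<Longrightarrow> m i = 0" by auto
  have "tensor_legendre m u = shifted_legendre (m j) (u $ j)" for u
    unfolding tensor_legendre_def using j(2) by (subst prod.remove[of _ j]) simp_all
  then have "copula_coeff m = expectation (\<lambda>\<omega>. shifted_legendre (m j) (U 0 \<omega> $ j))"
    by (simp add: copula_coeff_def)
  also have "\<dots> = integral {0..1} (shifted_legendre (m j))"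
    by (rule expectation_U) (intro continuous_intros)
  also have "\<dots> = 0" using shifted_legendre_orthonormal[of "m j" 0] j(1) by simp
  finally show ?thesis .
qed

lemma integrable_estimator_error:
  "integrable M (\<lambda>\<omega>. (copula_coeff_estimator n (\<lambda>i. X i \<omega>) m - copula_coeff m)\<^sup>2)"
proof -
  define b where "b = sqrt (real (2 * Max (range m) + 1)) ^ CARD('d)"
  have b: "\<bar>tensor_legendre m (pseudo_obs n i \<omega>)\<bar> \<le> b" for i \<omega>
    unfolding b_def by (rule abs_tensor_legendre_le[OF pseudo_obs_in_cube]) simp
  \<comment> \<open>One bound for all three branches of the estimator. The average is at most
    \<open>b\<close> even for \<open>n = 0\<close>, where the quotient is 0 by convention.\<close>
  have "\<bar>copula_coeff_estimator n (\<lambda>i. X i \<omega>) m\<bar> \<le> 1 + b" for \<omega>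
  proof -
    have "b \<ge> 0" by (simp add: b_def)
    have "\<bar>\<Sum>i<n. tensor_legendre m (pseudo_obs n i \<omega>)\<bar> \<le> (\<Sum>i<n. b)"
      using b by (intro order_trans[OF sum_abs] sum_mono) auto
    then have "\<bar>\<Sum>i<n. tensor_legendre m (pseudo_obs n i \<omega>)\<bar> / real n \<le> b"
      using \<open>b \<ge> 0\<close> by (cases "n = 0") (simp_all add: divide_le_eq mult.commute)
    then show ?thesis
      using \<open>b \<ge> 0\<close> by (simp add: copula_coeff_estimator_def flip: pseudo_obs_def)
  qed
  then have "\<bar>copula_coeff_estimator n (\<lambda>i. X i \<omega>) m - copula_coeff m\<bar> \<le> \<bar>1 + b + \<bar>copula_coeff m\<bar>\<bar>" for \<omega>
    using abs_triangle_ineq4[of "copula_coeff_estimator n (\<lambda>i. X i \<omega>) m" "copula_coeff m"]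
    by (meson abs_ge_self add_right_mono order_trans)
  then have "(copula_coeff_estimator n (\<lambda>i. X i \<omega>) m - copula_coeff m)\<^sup>2 \<le> (1 + b + \<bar>copula_coeff m\<bar>)\<^sup>2" for \<omega>
    by (simp only: abs_le_square_iff)
  then show ?thesis
    by (intro integrable_const_bound[of _ "(1 + b + \<bar>copula_coeff m\<bar>)\<^sup>2"]) auto
qed

text \<open>Only the third case is random. There the error splits into the substitution part
  \<open>\<delta>\<close> and the sampling part \<open>w\<close>, at the price of a factor 2.
  Cauchy-Schwarz over the coordinates gives one \<open>d\<close> and \<open>expectation D\<close>
  gives \<open>2 d\<close>, hence \<open>4 d^2\<close>; the 8 is 2 times the 4 of
  \<open>sampling_error\<close>.\<close>

lemma estimator_error:
  assumes m: "\<And>j. m j \<le> K" and n: "n > 0"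
  shows "expectation (\<lambda>\<omega>. (copula_coeff_estimator n (\<lambda>i. X i \<omega>) m - copula_coeff m)\<^sup>2)
    \<le> (4 * (real CARD('d))\<^sup>2 * (real K * real (Suc K))\<^sup>2 + 8) * real (2 * K + 1) ^ CARD('d) / real n"
    (is "?E \<le> ?R")
proof -
  consider "m = (\<lambda>_. 0)" | "m \<noteq> (\<lambda>_. 0)" "card {j. m j = 0} = CARD('d) - 1"
    | "m \<noteq> (\<lambda>_. 0)" "card {j. m j = 0} \<noteq> CARD('d) - 1" by blast
  then show ?thesis
  proof cases
    case 1
    then have "?E = 0" by (simp add: copula_coeff_estimator_def)
    moreover have "0 \<le> ?R" by simp
    ultimately show ?thesis by linarith
  next
    case 2
    then have "?E = 0" by (simp add: copula_coeff_estimator_def copula_coeff_single)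
    moreover have "0 \<le> ?R" by simp
    ultimately show ?thesis by linarith
  next
    case 3
    define d where "d = real CARD('d)"
    define B where "B = real (2 * K + 1) ^ CARD('d)"
    define L where "L = sqrt (real (2 * K + 1)) ^ CARD('d) * (real K * real (Suc K))"
    have L: "L\<^sup>2 = B * (real K * real (Suc K))\<^sup>2"
      by (simp add: L_def B_def power_mult_distrib flip: power_mult) 
        (simp add: power2_eq_square mult.commute[of _ 2] power_mult)
    define \<delta> where "\<delta> i \<omega> = tensor_legendre m (pseudo_obs n i \<omega>) - tensor_legendre m (U i \<omega>)" for i \<omega>
    define w where "w i \<omega> = tensor_legendre m (U i \<omega>) - copula_coeff m" for i \<omega>
    \<comment> \<open>All squared rank errors together: there are \<open>n d\<close> of them, each
      of mean at most \<open>2 / n\<close>, so the mean of \<open>D\<close> is bounded independently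
      of \<open>n\<close>.\<close>
    define D where "D \<omega> = (\<Sum>i<n. \<Sum>j\<in>UNIV. (pseudo_obs n i \<omega> $ j - U i \<omega> $ j)\<^sup>2)" for \<omega>
    have D_int: "integrable M D"
      unfolding D_def[abs_def] by (intro Bochner_Integration.integrable_sum integrable_pseudo_obs_error)
    have "expectation D = (\<Sum>i<n. \<Sum>j\<in>UNIV. expectation (\<lambda>\<omega>. (pseudo_obs n i \<omega> $ j - U i \<omega> $ j)\<^sup>2))"
      unfolding D_def[abs_def]
      by (simp add: Bochner_Integration.integral_sum integrable_pseudo_obs_error)
    also have "\<dots> \<le> (\<Sum>i<n. \<Sum>j\<in>(UNIV :: 'd set). 2 / real n)"
      by (intro sum_mono pseudo_obs_error) simp
    also have "\<dots> = 2 * d" using n by (simp add: d_def)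
    finally have D_le: "expectation D \<le> 2 * d" .
    have w_le: "expectation (\<lambda>\<omega>. (\<Sum>i<n. w i \<omega>)\<^sup>2) \<le> 4 * B * real n"
      unfolding w_def B_def by (rule sampling_error[OF m])
    have w_int: "integrable M (\<lambda>\<omega>. (\<Sum>i<n. w i \<omega>)\<^sup>2)"
    proof (rule integrable_const_bound)
      have w_bound: "\<bar>w i \<omega>\<bar> \<le> 2 * sqrt (real (2 * K + 1)) ^ CARD('d)" for i \<omega>
        using abs_tensor_legendre_le[where m = m and K = K, OF U_in_cube m, of i \<omega>] abs_copula_coeff_le[where m = m and K = K, OF m]
        unfolding w_def by linarith
      have "\<bar>\<Sum>i<n. w i \<omega>\<bar> \<le> \<bar>real n * (2 * sqrt (real (2 * K + 1)) ^ CARD('d))\<bar>" for \<omega>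
        using order_trans[OF sum_abs sum_mono[of "{..<n}", OF w_bound]] by simp
      then show "AE \<omega> in M. norm ((\<Sum>i<n. w i \<omega>)\<^sup>2) \<le> (real n * (2 * sqrt (real (2 * K + 1)) ^ CARD('d)))\<^sup>2"
        unfolding abs_le_square_iff by simp
    qed (simp add: w_def)
    have pointwise: "(copula_coeff_estimator n (\<lambda>i. X i \<omega>) m - copula_coeff m)\<^sup>2
       \<le> 2 * L\<^sup>2 * d / real n * D \<omega> + 2 / (real n)\<^sup>2 * (\<Sum>i<n. w i \<omega>)\<^sup>2" for \<omega>
    proof -
      have "(\<delta> i \<omega>)\<^sup>2 \<le> L\<^sup>2 * d * (\<Sum>j\<in>UNIV. (pseudo_obs n i \<omega> $ j - U i \<omega> $ j)\<^sup>2)" for i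
      proof -
        have "\<bar>\<delta> i \<omega>\<bar> \<le> \<bar>L * (\<Sum>j\<in>UNIV. \<bar>pseudo_obs n i \<omega> $ j - U i \<omega> $ j\<bar>)\<bar>"
          using tensor_legendre_lipschitz[where m = m and K = K, OF pseudo_obs_in_cube U_in_cube m, of n i \<omega> i \<omega>]
          unfolding \<delta>_def L_def by linarith
        then have "(\<delta> i \<omega>)\<^sup>2 \<le> L\<^sup>2 * (\<Sum>j\<in>UNIV. \<bar>pseudo_obs n i \<omega> $ j - U i \<omega> $ j\<bar>)\<^sup>2"
          unfolding abs_le_square_iff by (simp only: power_mult_distrib)
        also have "\<dots> \<le> L\<^sup>2 * ((\<Sum>j\<in>UNIV. \<bar>pseudo_obs n i \<omega> $ j - U i \<omega> $ j\<bar>\<^sup>2) * d)"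
          unfolding d_def by (intro mult_left_mono sum_squared_le_sum_of_squares) simp
        finally show ?thesis by (simp add: mult_ac)
      qed
      then have "(\<Sum>i<n. (\<delta> i \<omega>)\<^sup>2) \<le> L\<^sup>2 * d * D \<omega>"
        unfolding D_def sum_distrib_left by (rule sum_mono)
      \<comment> \<open>Cauchy-Schwarz over the observations. The \<open>\<delta> i\<close> are
        dependent, so no gain from averaging is sought: each is already small.\<close>
      then have \<delta>: "(\<Sum>i<n. \<delta> i \<omega>)\<^sup>2 \<le> real n * (L\<^sup>2 * d * D \<omega>)"
        using sum_squared_le_sum_of_squares[where f = "\<lambda>i. \<delta> i \<omega>" and I = "{..<n}"] n
        by (simp add: mult.commute) (meson mult_left_mono of_nat_0_le_iff order_trans)
      have "copula_coeff_estimator n (\<lambda>i. X i \<omega>) m - copula_coeff m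
          = ((\<Sum>i<n. \<delta> i \<omega>) + (\<Sum>i<n. w i \<omega>)) / real n"
        using 3 n by (simp add: copula_coeff_estimator_def \<delta>_def w_def sum_subtractf field_simps
            flip: pseudo_obs_def)
      then have "(copula_coeff_estimator n (\<lambda>i. X i \<omega>) m - copula_coeff m)\<^sup>2
          = ((\<Sum>i<n. \<delta> i \<omega>) + (\<Sum>i<n. w i \<omega>))\<^sup>2 / (real n)\<^sup>2"
        by (simp add: power_divide)
      also have "\<dots> \<le> (2 * (\<Sum>i<n. \<delta> i \<omega>)\<^sup>2 + 2 * (\<Sum>i<n. w i \<omega>)\<^sup>2) / (real n)\<^sup>2"
        using sum_squares_bound[of "\<Sum>i<n. \<delta> i \<omega>" "\<Sum>i<n. w i \<omega>"]
        by (intro divide_right_mono) (simp_all add: power2_sum)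
      also have "\<dots> \<le> (2 * (real n * (L\<^sup>2 * d * D \<omega>)) + 2 * (\<Sum>i<n. w i \<omega>)\<^sup>2) / (real n)\<^sup>2"
        using \<delta> by (intro divide_right_mono add_mono mult_left_mono) simp_all
      also have "\<dots> = 2 * L\<^sup>2 * d / real n * D \<omega> + 2 / (real n)\<^sup>2 * (\<Sum>i<n. w i \<omega>)\<^sup>2"
        using n by (simp add: add_divide_distrib power2_eq_square)
      finally show ?thesis .
    qed
    have "?E \<le> expectation (\<lambda>\<omega>. 2 * L\<^sup>2 * d / real n * D \<omega> + 2 / (real n)\<^sup>2 * (\<Sum>i<n. w i \<omega>)\<^sup>2)"
      using D_int w_int by (intro integral_mono integrable_estimator_error pointwise) simp_all
    also have "\<dots> = 2 * L\<^sup>2 * d / real n * expectation D + 2 / (real n)\<^sup>2 * expectation (\<lambda>\<omega>. (\<Sum>i<n. w i \<omega>)\<^sup>2)"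
      using D_int w_int by simp
    also have "\<dots> \<le> 2 * L\<^sup>2 * d / real n * (2 * d) + 2 / (real n)\<^sup>2 * (4 * B * real n)"
      using D_le w_le by (intro add_mono mult_left_mono) (simp_all add: d_def)
    also have "\<dots> = ?R"
      using n unfolding L B_def[symmetric] d_def[symmetric]
      by (simp add: power2_eq_square field_simps)
    finally show ?thesis .
  qed
qed

lemma card_multi_index_le:
  fixes N :: "'d \<Rightarrow> nat"
  assumes "\<And>j. N j \<le> K"
  shows "card {m. m \<le> N} \<le> Suc K ^ CARD('d)"
proof -
  have "{m. m \<le> N} \<subseteq> (\<Pi>\<^sub>E j\<in>UNIV. {..K})"
    using assms by (auto simp: le_fun_def intro: order_trans)
  then have "card {m. m \<le> N} \<le> card (\<Pi>\<^sub>E j\<in>(UNIV :: 'd set). {..K})"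
    by (intro card_mono finite_PiE) simp_all
  then show ?thesis by (simp add: card_PiE)
qed

text \<open>For \<open>K \<ge> 1\<close> one has \<open>K + 1 \<le> 2 K\<close> and
  \<open>2 K + 1 \<le> 3 K\<close>: the first gives \<open>2 ^ d\<close> in the number of indices,
  the second \<open>3 ^ d\<close> in the normalization, together \<open>6 ^ d\<close>. The first
  also turns \<open>4 d^2\<close> into \<open>16 d^2\<close>.\<close>

lemma sum_estimator_error:
  assumes N: "\<And>j. N j \<le> K" and "n > 0" "K > 0"
  shows "(\<Sum>m | m \<le> N. expectation (\<lambda>\<omega>. (copula_coeff_estimator n (\<lambda>i. X i \<omega>) m - copula_coeff m)\<^sup>2))
    \<le> 6 ^ CARD('d) * (16 * (real CARD('d))\<^sup>2 + 8) * (real K ^ (2 * CARD('d) + 4) / real n)"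
proof -
  define d where "d = CARD('d)"
  define k where "k = real K"
  have k: "k \<ge> 1" using \<open>K > 0\<close> by (simp add: k_def)
  define R where "R = (4 * (real d)\<^sup>2 * (k * real (Suc K))\<^sup>2 + 8) * real (2 * K + 1) ^ d / real n"
  have R: "expectation (\<lambda>\<omega>. (copula_coeff_estimator n (\<lambda>i. X i \<omega>) m - copula_coeff m)\<^sup>2) \<le> R"
    if "m \<le> N" for m
    unfolding R_def d_def k_def
    using that N \<open>n > 0\<close> by (intro estimator_error) (auto simp: le_fun_def intro: order_trans)
  have "R \<ge> 0" by (simp add: R_def)
  have "(\<Sum>m | m \<le> N. expectation (\<lambda>\<omega>. (copula_coeff_estimator n (\<lambda>i. X i \<omega>) m - copula_coeff m)\<^sup>2))
     \<le> real (card {m. m \<le> N}) * R"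
    using R sum_bounded_above[of "{m. m \<le> N}" _ R] by simp
  also have "\<dots> \<le> real (Suc K ^ d) * R"
    unfolding d_def using \<open>R \<ge> 0\<close> by (intro mult_right_mono of_nat_mono card_multi_index_le N)
  also have "\<dots> \<le> (2 * k) ^ d * ((16 * (real d)\<^sup>2 + 8) * k ^ 4 * (3 * k) ^ d / real n)"
  proof (intro mult_mono)
    show "real (Suc K ^ d) \<le> (2 * k) ^ d"
      unfolding of_nat_power using k by (intro power_mono) (simp_all add: k_def)
    have "(k * real (Suc K))\<^sup>2 \<le> (k * (2 * k))\<^sup>2"
      using k by (intro power_mono mult_mono) (simp_all add: k_def)
    then have "(k * real (Suc K))\<^sup>2 \<le> 4 * k ^ 4"
      by (simp add: power2_eq_square power4_eq_xxxx mult_ac)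
    then have "4 * (real d)\<^sup>2 * (k * real (Suc K))\<^sup>2 + 8 * 1 \<le> 4 * (real d)\<^sup>2 * (4 * k ^ 4) + 8 * k ^ 4"
      using one_le_power[OF k, of 4] by (intro add_mono mult_left_mono) simp_all
    then have c: "4 * (real d)\<^sup>2 * (k * real (Suc K))\<^sup>2 + 8 \<le> (16 * (real d)\<^sup>2 + 8) * k ^ 4"
      by (simp add: algebra_simps)
    have "real (2 * K + 1) ^ d \<le> (3 * k) ^ d"
      using k by (intro power_mono) (simp_all add: k_def)
    then show "R \<le> (16 * (real d)\<^sup>2 + 8) * k ^ 4 * (3 * k) ^ d / real n"
      unfolding R_def using k by (intro divide_right_mono mult_mono c) auto
  qed (use k \<open>R \<ge> 0\<close> in auto)
  also have "\<dots> = (2 * 3) ^ d * (16 * (real d)\<^sup>2 + 8) * (k ^ (2 * d + 4) / real n)"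
  proof -
    have "2 * d + 4 = d + d + 4" by simp
    then show ?thesis unfolding power_mult_distrib by (simp only: power_add) (simp add: mult_ac)
  qed
  finally show ?thesis by (simp add: d_def k_def)
qed

section \<open>Bias, variance and the limit\<close>

lemma copula_coeff_eq_legendre_coeff:
  assumes c: "copula_density M (X 0) c"
  shows "copula_coeff m = legendre_coeff c m"
proof -
  have [measurable]: "c \<in> borel_measurable cube_measure"
    and nonneg: "AE u in cube_measure. 0 \<le> c u"
    and distr: "distributed M cube_measure (U 0) (\<lambda>u. ennreal (c u))"
    using c by (simp_all add: copula_density_def U_def[abs_def] F_def)
  have [measurable]: "U 0 \<in> measurable M cube_measure"
    using distr by (simp add: distributed_def)
  have [measurable]: "tensor_legendre m \<in> borel_measurable cube_measure"
    by (rule measurable_cube_measureI) simp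
  have "copula_coeff m = integral\<^sup>L (distr M cube_measure (U 0)) (tensor_legendre m)"
    unfolding copula_coeff_def by (subst integral_distr) simp_all
  also have "\<dots> = integral\<^sup>L (density cube_measure (\<lambda>u. ennreal (c u))) (tensor_legendre m)"
    using distr by (simp add: distributed_def)
  also have "\<dots> = legendre_coeff c m"
    unfolding legendre_coeff_def using nonneg by (subst integral_density) simp_all
  finally show ?thesis .
qed

lemma MISE_le:
  assumes c: "copula_density M (X 0) c" "integrable cube_measure (\<lambda>u. (c u)\<^sup>2)"
  shows "MISE M X c n N \<le> ennreal
    (2 * (\<Sum>m | m \<le> N. expectation (\<lambda>\<omega>. (copula_coeff_estimator n (\<lambda>i. X i \<omega>) m - copula_coeff m)\<^sup>2))
      + 2 * (\<integral>u. (c u - legendre_proj N c u)\<^sup>2 \<partial>cube_measure))"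
proof -
  have c_meas: "c \<in> borel_measurable cube_measure" using c(1) by (simp add: copula_density_def)
  define e where "e m \<omega> = copula_coeff_estimator n (\<lambda>i. X i \<omega>) m - copula_coeff m" for m \<omega>
  define b where "b = (\<integral>u. (c u - legendre_proj N c u)\<^sup>2 \<partial>cube_measure)"
  have "b \<ge> 0" by (simp add: b_def)
  have P_meas: "legendre_proj N c \<in> borel_measurable cube_measure"
    by (intro measurable_cube_measureI borel_measurable_continuous_onI continuous_on_legendre_proj)
  have bias_int: "integrable cube_measure (\<lambda>u. (c u - legendre_proj N c u)\<^sup>2)"
    by (rule integrable_diff_square[OF c_meas P_meas c(2)])
      (intro integrable_cube_continuous continuous_intros continuous_on_legendre_proj)
  have inner: "(\<integral>\<^sup>+u. ennreal ((copula_density_estimator n N (\<lambda>i. X i \<omega>) u - c u)\<^sup>2) \<partial>cube_measure)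
     \<le> ennreal (2 * (\<Sum>m | m \<le> N. (e m \<omega>)\<^sup>2) + 2 * b)" for \<omega>
  proof -
    define s where "s u = (\<Sum>m | m \<le> N. e m \<omega> * tensor_legendre m u)" for u
    have s_int: "integrable cube_measure (\<lambda>u. (s u)\<^sup>2)"
      unfolding s_def by (intro integrable_cube_continuous continuous_intros continuous_on_tensor_legendre)
    have s_integral: "(\<integral>u. (s u)\<^sup>2 \<partial>cube_measure) = (\<Sum>m | m \<le> N. (e m \<omega>)\<^sup>2)"
      unfolding s_def by (rule integral_legendre_sum_square) simp
    \<comment> \<open>Inserting the projection of \<open>c\<close> separates the random coefficient
      errors from the deterministic residual. The pointwise inequality below removes the mixed term
      for a factor 2, harmless in the limit.\<close>
    have "copula_density_estimator n N (\<lambda>i. X i \<omega>) u - c u = s u - (c u - legendre_proj N c u)" for u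
      by (simp add: copula_density_estimator_def s_def e_def legendre_proj_def
          copula_coeff_eq_legendre_coeff[OF c(1)] left_diff_distrib sum_subtractf)
    moreover have "(a - b)\<^sup>2 \<le> 2 * a\<^sup>2 + 2 * b\<^sup>2" for a b :: real
      using zero_le_power2[of "a + b"] by (simp add: power2_diff power2_sum)
    ultimately have "(copula_density_estimator n N (\<lambda>i. X i \<omega>) u - c u)\<^sup>2
       \<le> 2 * (s u)\<^sup>2 + 2 * (c u - legendre_proj N c u)\<^sup>2" for u
      by (simp only:)
    then have "(\<integral>\<^sup>+u. ennreal ((copula_density_estimator n N (\<lambda>i. X i \<omega>) u - c u)\<^sup>2) \<partial>cube_measure)
      \<le> (\<integral>\<^sup>+u. ennreal (2 * (s u)\<^sup>2 + 2 * (c u - legendre_proj N c u)\<^sup>2) \<partial>cube_measure)"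
      by (intro nn_integral_mono ennreal_leI)
    also have "\<dots> = ennreal (\<integral>u. 2 * (s u)\<^sup>2 + 2 * (c u - legendre_proj N c u)\<^sup>2 \<partial>cube_measure)"
      using s_int bias_int by (intro nn_integral_eq_integral) simp_all
    finally show ?thesis using s_int bias_int s_integral by (simp add: b_def)
  qed
  have e_int: "integrable M (\<lambda>\<omega>. (e m \<omega>)\<^sup>2)" for m
    unfolding e_def by (rule integrable_estimator_error)
  have "MISE M X c n N \<le> (\<integral>\<^sup>+\<omega>. ennreal (2 * (\<Sum>m | m \<le> N. (e m \<omega>)\<^sup>2) + 2 * b) \<partial>M)"
    unfolding MISE_def by (intro nn_integral_mono inner)
  also have "\<dots> = ennreal (expectation (\<lambda>\<omega>. 2 * (\<Sum>m | m \<le> N. (e m \<omega>)\<^sup>2) + 2 * b))"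
    using e_int \<open>b \<ge> 0\<close> by (intro nn_integral_eq_integral) (simp_all add: sum_nonneg)
  also have "expectation (\<lambda>\<omega>. 2 * (\<Sum>m | m \<le> N. (e m \<omega>)\<^sup>2) + 2 * b)
    = 2 * (\<Sum>m | m \<le> N. expectation (\<lambda>\<omega>. (e m \<omega>)\<^sup>2)) + 2 * b"
    using e_int by (simp add: prob_space Bochner_Integration.integral_sum)
  finally show ?thesis by (simp add: e_def b_def)
qed

end

text \<open>The growth condition limits \<open>N\<close> only from above and drives the variance to
  0. A constant \<open>N\<close> meets it while the bias stays at a generally positive value; the
  divergence of every component of \<open>N\<close> is what makes the bias vanish.\<close>

theorem corollary2:
  fixes M :: "'a measure"
    and X :: "nat \<Rightarrow> 'a \<Rightarrow> real ^ 'd::finite"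
    and c :: "real ^ 'd \<Rightarrow> real"
    and N :: "nat \<Rightarrow> 'd \<Rightarrow> nat"
  assumes "prob_space M"
    and "prob_space.indep_vars M (\<lambda>_. borel) X UNIV"
    and "\<And>i. distr M borel (X i) = distr M borel (X 0)"
    and "\<And>j. continuous_on UNIV (marginal_cdf M (X 0) j)"
    and "copula_density M (X 0) c"
    and "integrable cube_measure (\<lambda>u. (c u)\<^sup>2)"
    and "\<And>j. filterlim (\<lambda>n. N n j) at_top sequentially"
    and "(\<lambda>n. real (Max (range (N n))) ^ (2 * CARD('d) + 4)) \<in> o(\<lambda>n. real n)"
  shows "(\<lambda>n. MISE M X c n (N n)) \<longlonglongrightarrow> 0"
proof -
  interpret copula_sample M X
    using assms(1-4) by (simp add: copula_sample_def copula_sample_axioms_def)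
  define K where "K n = Max (range (N n))" for n
  have N_le: "N n j \<le> K n" for n j by (simp add: K_def)
  define C where "C = 6 ^ CARD('d) * (16 * (real CARD('d))\<^sup>2 + 8)"
  define bias where "bias n = (\<integral>u. (c u - legendre_proj (N n) c u)\<^sup>2 \<partial>cube_measure)" for n
  have c_meas: "c \<in> borel_measurable cube_measure" using assms(5) by (simp add: copula_density_def)
  have bias: "bias \<longlonglongrightarrow> 0"
    unfolding bias_def by (rule legendre_proj_L2_tendsto[OF c_meas assms(6,7)])
  have variance: "(\<lambda>n. real (K n) ^ (2 * CARD('d) + 4) / real n) \<longlonglongrightarrow> 0"
    using smalloD_tendsto[OF assms(8)] by (simp add: K_def)
  have "(\<lambda>n. 2 * (C * (real (K n) ^ (2 * CARD('d) + 4) / real n)) + 2 * bias n) \<longlonglongrightarrow> 2 * (C * 0) + 2 * 0"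
    by (intro tendsto_intros bias variance)
  from tendsto_ennrealI[OF this]
  have lim: "(\<lambda>n. ennreal (2 * (C * (real (K n) ^ (2 * CARD('d) + 4) / real n)) + 2 * bias n)) \<longlonglongrightarrow> 0"
    by simp
  have upper: "eventually (\<lambda>n. MISE M X c n (N n) \<le>
      ennreal (2 * (C * (real (K n) ^ (2 * CARD('d) + 4) / real n)) + 2 * bias n)) sequentially"
  proof -
    \<comment> \<open>The explicit variance bound is valid only for \<open>K n > 0\<close> and
      \<open>n > 0\<close>, so it is used for large \<open>n\<close> only.\<close>
    have "eventually (\<lambda>n. \<forall>j. 1 \<le> N n j) sequentially"
      using assms(7) by (simp add: filterlim_at_top eventually_all_finite)
    then show ?thesis
      using eventually_gt_at_top[of 0]
    proof eventually_elim
      case (elim n)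
      then have "K n > 0" using N_le[of n undefined] by (metis less_le_trans zero_less_one)
      from sum_estimator_error[OF N_le elim(2) this]
      have "ennreal (2 * (\<Sum>m | m \<le> N n. expectation (\<lambda>\<omega>. (copula_coeff_estimator n (\<lambda>i. X i \<omega>) m - copula_coeff m)\<^sup>2))
          + 2 * bias n) \<le> ennreal (2 * (C * (real (K n) ^ (2 * CARD('d) + 4) / real n)) + 2 * bias n)"
        unfolding C_def by (intro ennreal_leI add_mono mult_left_mono) simp_all
      with MISE_le[OF assms(5,6), of n "N n"] show ?case
        unfolding bias_def[symmetric] by (rule order_trans)
    qed
  qed
  have "eventually (\<lambda>n. 0 \<le> MISE M X c n (N n)) sequentially" by simp
  then show ?thesis by (rule tendsto_sandwich[OF _ upper tendsto_const lim])
qed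

end
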